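(* Let $(\mathcal{M},\mathcal{W})$ be a base of enrichment. There exists a bicategory $\mathcal{W}^{-1}\mathcal{M}$ together with a homomorphism $L_{\mathcal{W}}:\mathcal{M}\to\mathcal{W}^{-1}\mathcal{M}$ such that: (a) $L_{\mathcal{W}}$ makes $\mathcal{W}$ invertible; (b) any homomorphism $\Phi:\mathcal{M}\to\mathcal{B}$ which makes $\mathcal{W}$ invertible factors as $\Phi=\overline{\Phi}\circ L_{\mathcal{W}}$ with $\overline{\Phi}:\mathcal{W}^{-1}\mathcal{M}\to\mathcal{B}$ a homomorphism; (c) $\mathcal{W}^{-1}\mathcal{M}$ is unique up to a biequivalence.
   Context: A base of enrichment is a pair $(\mathcal{M},\mathcal{W})$ with $\mathcal{M}$ a bicategory and $\mathcal{W}$ a class of $2$-cells of $\mathcal{M}$ such that: every invertible $2$-cell of $\mathcal{M}$ is in $\mathcal{W}$ (in particular the identity $2$-cells); $\mathcal{W}$ has the vertical $3$-out-of-$2$ property (if two of $\alpha$, $\beta$ and the vertical composite $\beta\star\alpha$ are in $\mathcal{W}$, then so is the third); $\mathcal{W}$ is stable under horizontal composition (if $\alpha$ and $\beta$ are in $\mathcal{W}$, then so is the horizontal composite $\beta\otimes\alpha$). A homomorphism of bicategories (in the sense of Bénabou) is a pseudofunctor, i.e. a morphism of bicategories whose comparison $2$-cells $\Phi g\otimes\Phi f\to\Phi(g\otimes f)$ and $I_{\Phi A}\to\Phi(I_A)$ are invertible. A homomorphism $\Phi:\mathcal{M}\to\mathcal{B}$, with $\mathcal{B}$ a bicategory, makes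 $\mathcal{W}$ invertible if for every pair $(U,V)$ of objects of $\mathcal{M}$ the functor $\Phi_{UV}:\mathcal{M}(U,V)\to\mathcal{B}(\Phi U,\Phi V)$ sends every $2$-cell of $\mathcal{W}$ lying in $\mathcal{M}(U,V)$ to an invertible $2$-cell. Biequivalence is the usual notion of equivalence between bicategories.
   Formalization: In (c), uniqueness up to biequivalence is proved among bicategories satisfying (a), (b) and also uniqueness of the factorization up to pseudonatural equivalence; with (a), (b) alone it fails (add an isolated object). The localization is shown to have this property. *)

theory Defs
  imports Main
begin

section \<open>Bicategories\<close>

text \<open>
  A bicategory is presented by its sets of objects, 1-cells and 2-cells, so that the category
  \<open>M(U,V)\<close> consists of the 1-cells with source \<open>U\<close> and target \<open>V\<close> and of the 2-cells between them.
  All operations are total functions which are only constrained on the carriers.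

  Compositions are written in applicative order: \<open>g \<otimes> f\<close> (on 1-cells) and \<open>\<beta> \<boxtimes> \<alpha>\<close> (on 2-cells) are
  the horizontal composites, \<open>\<beta> \<star> \<alpha>\<close> is the vertical composite.  The constraint cells are
  \<open>associator h g f : (h \<otimes> g) \<otimes> f \<rightarrow> h \<otimes> (g \<otimes> f)\<close>, \<open>lunitor f : I \<otimes> f \<rightarrow> f\<close> and
  \<open>runitor f : f \<otimes> I \<rightarrow> f\<close>.
\<close>

record ('o, 'm, 'c) bicat =
  objs :: "'o set"
  arrs :: "'m set"
  cells :: "'c set"
  src :: "'m \<Rightarrow> 'o"
  trg :: "'m \<Rightarrow> 'o"
  dom2 :: "'c \<Rightarrow> 'm"
  cod2 :: "'c \<Rightarrow> 'm"
  id1 :: "'o \<Rightarrow> 'm"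
  comp1 :: "'m \<Rightarrow> 'm \<Rightarrow> 'm" (infixl "\<otimes>\<index>" 70)
  id2 :: "'m \<Rightarrow> 'c"
  vcomp :: "'c \<Rightarrow> 'c \<Rightarrow> 'c" (infixl "\<star>\<index>" 65)
  hcomp :: "'c \<Rightarrow> 'c \<Rightarrow> 'c" (infixl "\<boxtimes>\<index>" 70)
  associator :: "'m \<Rightarrow> 'm \<Rightarrow> 'm \<Rightarrow> 'c"
  lunitor :: "'m \<Rightarrow> 'c"
  runitor :: "'m \<Rightarrow> 'c"

definition hom1 :: "('o, 'm, 'c) bicat \<Rightarrow> 'o \<Rightarrow> 'o \<Rightarrow> 'm set" where
  "hom1 B U V = {f \<in> arrs B. src B f = U \<and> trg B f = V}"

definition hom2 :: "('o, 'm, 'c) bicat \<Rightarrow> 'm \<Rightarrow> 'm \<Rightarrow> 'c set" where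
  "hom2 B f g = {\<alpha> \<in> cells B. dom2 B \<alpha> = f \<and> cod2 B \<alpha> = g}"

definition inverse2 :: "('o, 'm, 'c) bicat \<Rightarrow> 'c \<Rightarrow> 'c \<Rightarrow> bool" where
  "inverse2 B \<alpha> \<beta> \<longleftrightarrow>
     \<alpha> \<in> cells B \<and> \<beta> \<in> hom2 B (cod2 B \<alpha>) (dom2 B \<alpha>) \<and>
     \<beta> \<star>\<^bsub>B\<^esub> \<alpha> = id2 B (dom2 B \<alpha>) \<and> \<alpha> \<star>\<^bsub>B\<^esub> \<beta> = id2 B (cod2 B \<alpha>)"

definition invertible2 :: "('o, 'm, 'c) bicat \<Rightarrow> 'c \<Rightarrow> bool" where
  "invertible2 B \<alpha> \<longleftrightarrow> (\<exists>\<beta>. inverse2 B \<alpha> \<beta>)"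

definition inv2 :: "('o, 'm, 'c) bicat \<Rightarrow> 'c \<Rightarrow> 'c" where
  "inv2 B \<alpha> = (THE \<beta>. inverse2 B \<alpha> \<beta>)"

locale bicategory =
  fixes B :: "('o, 'm, 'c) bicat" (structure)
  assumes src_in_objs: "f \<in> arrs B \<Longrightarrow> src B f \<in> objs B"
    and trg_in_objs: "f \<in> arrs B \<Longrightarrow> trg B f \<in> objs B"
    and dom2_in_arrs: "\<alpha> \<in> cells B \<Longrightarrow> dom2 B \<alpha> \<in> arrs B"
    and cod2_in_arrs: "\<alpha> \<in> cells B \<Longrightarrow> cod2 B \<alpha> \<in> arrs B"
    and src_dom2: "\<alpha> \<in> cells B \<Longrightarrow> src B (dom2 B \<alpha>) = src B (cod2 B \<alpha>)"
    and trg_dom2: "\<alpha> \<in> cells B \<Longrightarrow> trg B (dom2 B \<alpha>) = trg B (cod2 B \<alpha>)"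
      \<comment> \<open>the categories \<open>B(U,V)\<close>\<close>
    and id2_in_hom2: "f \<in> arrs B \<Longrightarrow> id2 B f \<in> hom2 B f f"
    and vcomp_in_hom2: "\<alpha> \<in> hom2 B f g \<Longrightarrow> \<beta> \<in> hom2 B g h \<Longrightarrow> \<beta> \<star> \<alpha> \<in> hom2 B f h"
    and vcomp_id2_left: "\<alpha> \<in> hom2 B f g \<Longrightarrow> id2 B g \<star> \<alpha> = \<alpha>"
    and vcomp_id2_right: "\<alpha> \<in> hom2 B f g \<Longrightarrow> \<alpha> \<star> id2 B f = \<alpha>"
    and vcomp_assoc: "\<alpha> \<in> hom2 B f g \<Longrightarrow> \<beta> \<in> hom2 B g h \<Longrightarrow> \<gamma> \<in> hom2 B h k \<Longrightarrow>
      (\<gamma> \<star> \<beta>) \<star> \<alpha> = \<gamma> \<star> (\<beta> \<star> \<alpha>)"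
      \<comment> \<open>the composition functors \<open>B(V,W) \<times> B(U,V) \<rightarrow> B(U,W)\<close> and the unit 1-cells\<close>
    and id1_in_hom1: "U \<in> objs B \<Longrightarrow> id1 B U \<in> hom1 B U U"
    and comp1_in_hom1: "f \<in> hom1 B U V \<Longrightarrow> g \<in> hom1 B V W \<Longrightarrow> g \<otimes> f \<in> hom1 B U W"
    and hcomp_in_hom2: "\<alpha> \<in> hom2 B f f' \<Longrightarrow> \<beta> \<in> hom2 B g g' \<Longrightarrow> src B g = trg B f \<Longrightarrow>
      \<beta> \<boxtimes> \<alpha> \<in> hom2 B (g \<otimes> f) (g' \<otimes> f')"
    and hcomp_id2: "f \<in> hom1 B U V \<Longrightarrow> g \<in> hom1 B V W \<Longrightarrow> id2 B g \<boxtimes> id2 B f = id2 B (g \<otimes> f)"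
    and interchange: "\<alpha> \<in> hom2 B f f' \<Longrightarrow> \<alpha>' \<in> hom2 B f' f'' \<Longrightarrow> \<beta> \<in> hom2 B g g' \<Longrightarrow>
      \<beta>' \<in> hom2 B g' g'' \<Longrightarrow> src B g = trg B f \<Longrightarrow>
      (\<beta>' \<star> \<beta>) \<boxtimes> (\<alpha>' \<star> \<alpha>) = (\<beta>' \<boxtimes> \<alpha>') \<star> (\<beta> \<boxtimes> \<alpha>)"
      \<comment> \<open>the constraint cells, their naturality and their coherence\<close>
    and associator_in_hom2: "f \<in> hom1 B U V \<Longrightarrow> g \<in> hom1 B V W \<Longrightarrow> h \<in> hom1 B W X \<Longrightarrow>
      associator B h g f \<in> hom2 B ((h \<otimes> g) \<otimes> f) (h \<otimes> (g \<otimes> f))"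
    and associator_invertible: "f \<in> hom1 B U V \<Longrightarrow> g \<in> hom1 B V W \<Longrightarrow> h \<in> hom1 B W X \<Longrightarrow>
      invertible2 B (associator B h g f)"
    and associator_natural: "\<alpha> \<in> hom2 B f f' \<Longrightarrow> \<beta> \<in> hom2 B g g' \<Longrightarrow> \<gamma> \<in> hom2 B h h' \<Longrightarrow>
      src B g = trg B f \<Longrightarrow> src B h = trg B g \<Longrightarrow>
      associator B h' g' f' \<star> ((\<gamma> \<boxtimes> \<beta>) \<boxtimes> \<alpha>) = (\<gamma> \<boxtimes> (\<beta> \<boxtimes> \<alpha>)) \<star> associator B h g f"
    and lunitor_in_hom2: "f \<in> hom1 B U V \<Longrightarrow> lunitor B f \<in> hom2 B (id1 B V \<otimes> f) f"
    and lunitor_invertible: "f \<in> arrs B \<Longrightarrow> invertible2 B (lunitor B f)"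
    and lunitor_natural: "\<alpha> \<in> hom2 B f g \<Longrightarrow>
      lunitor B g \<star> (id2 B (id1 B (trg B f)) \<boxtimes> \<alpha>) = \<alpha> \<star> lunitor B f"
    and runitor_in_hom2: "f \<in> hom1 B U V \<Longrightarrow> runitor B f \<in> hom2 B (f \<otimes> id1 B U) f"
    and runitor_invertible: "f \<in> arrs B \<Longrightarrow> invertible2 B (runitor B f)"
    and runitor_natural: "\<alpha> \<in> hom2 B f g \<Longrightarrow>
      runitor B g \<star> (\<alpha> \<boxtimes> id2 B (id1 B (src B f))) = \<alpha> \<star> runitor B f"
    and pentagon: "f \<in> hom1 B U V \<Longrightarrow> g \<in> hom1 B V W \<Longrightarrow> h \<in> hom1 B W X \<Longrightarrow> k \<in> hom1 B X Y \<Longrightarrow>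
      (id2 B k \<boxtimes> associator B h g f) \<star> associator B k (h \<otimes> g) f \<star> (associator B k h g \<boxtimes> id2 B f)
      = associator B k h (g \<otimes> f) \<star> associator B (k \<otimes> h) g f"
    and triangle: "f \<in> hom1 B U V \<Longrightarrow> g \<in> hom1 B V W \<Longrightarrow>
      (id2 B g \<boxtimes> lunitor B f) \<star> associator B g (id1 B V) f = runitor B g \<boxtimes> id2 B f"


section \<open>Homomorphisms of bicategories\<close>

text \<open>
  The comparison cells are \<open>on_comp \<Phi> g f : \<Phi> g \<otimes> \<Phi> f \<rightarrow> \<Phi> (g \<otimes> f)\<close> and
  \<open>on_unit \<Phi> A : I\<^sub>\<Phi>\<^sub>A \<rightarrow> \<Phi> I\<^sub>A\<close>.
\<close>

record ('o, 'm, 'c, 'p, 'n, 'd) bimorphism =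
  on_obj :: "'o \<Rightarrow> 'p"
  on_arr :: "'m \<Rightarrow> 'n"
  on_cell :: "'c \<Rightarrow> 'd"
  on_comp :: "'m \<Rightarrow> 'm \<Rightarrow> 'd"
  on_unit :: "'o \<Rightarrow> 'd"

locale homomorphism = M: bicategory M + B: bicategory B
  for M :: "('o, 'm, 'c) bicat" and B :: "('p, 'n, 'd) bicat" +
  fixes \<Phi> :: "('o, 'm, 'c, 'p, 'n, 'd) bimorphism"
  assumes on_obj_in_objs: "A \<in> objs M \<Longrightarrow> on_obj \<Phi> A \<in> objs B"
    and on_arr_in_hom1: "f \<in> hom1 M U V \<Longrightarrow> on_arr \<Phi> f \<in> hom1 B (on_obj \<Phi> U) (on_obj \<Phi> V)"
    and on_cell_in_hom2: "\<alpha> \<in> hom2 M f g \<Longrightarrow> on_cell \<Phi> \<alpha> \<in> hom2 B (on_arr \<Phi> f) (on_arr \<Phi> g)"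
    and on_cell_id2: "f \<in> arrs M \<Longrightarrow> on_cell \<Phi> (id2 M f) = id2 B (on_arr \<Phi> f)"
    and on_cell_vcomp: "\<alpha> \<in> hom2 M f g \<Longrightarrow> \<beta> \<in> hom2 M g h \<Longrightarrow>
      on_cell \<Phi> (\<beta> \<star>\<^bsub>M\<^esub> \<alpha>) = on_cell \<Phi> \<beta> \<star>\<^bsub>B\<^esub> on_cell \<Phi> \<alpha>"
    and on_comp_in_hom2: "f \<in> hom1 M U V \<Longrightarrow> g \<in> hom1 M V W \<Longrightarrow>
      on_comp \<Phi> g f \<in> hom2 B (on_arr \<Phi> g \<otimes>\<^bsub>B\<^esub> on_arr \<Phi> f) (on_arr \<Phi> (g \<otimes>\<^bsub>M\<^esub> f))"
    and on_comp_invertible: "f \<in> hom1 M U V \<Longrightarrow> g \<in> hom1 M V W \<Longrightarrow> invertible2 B (on_comp \<Phi> g f)"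
    and on_comp_natural: "\<alpha> \<in> hom2 M f f' \<Longrightarrow> \<beta> \<in> hom2 M g g' \<Longrightarrow> src M g = trg M f \<Longrightarrow>
      on_comp \<Phi> g' f' \<star>\<^bsub>B\<^esub> (on_cell \<Phi> \<beta> \<boxtimes>\<^bsub>B\<^esub> on_cell \<Phi> \<alpha>)
      = on_cell \<Phi> (\<beta> \<boxtimes>\<^bsub>M\<^esub> \<alpha>) \<star>\<^bsub>B\<^esub> on_comp \<Phi> g f"
    and on_unit_in_hom2: "A \<in> objs M \<Longrightarrow>
      on_unit \<Phi> A \<in> hom2 B (id1 B (on_obj \<Phi> A)) (on_arr \<Phi> (id1 M A))"
    and on_unit_invertible: "A \<in> objs M \<Longrightarrow> invertible2 B (on_unit \<Phi> A)"
    and on_associator: "f \<in> hom1 M U V \<Longrightarrow> g \<in> hom1 M V W \<Longrightarrow> h \<in> hom1 M W X \<Longrightarrow>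
      on_cell \<Phi> (associator M h g f) \<star>\<^bsub>B\<^esub> on_comp \<Phi> (h \<otimes>\<^bsub>M\<^esub> g) f
        \<star>\<^bsub>B\<^esub> (on_comp \<Phi> h g \<boxtimes>\<^bsub>B\<^esub> id2 B (on_arr \<Phi> f))
      = on_comp \<Phi> h (g \<otimes>\<^bsub>M\<^esub> f) \<star>\<^bsub>B\<^esub> (id2 B (on_arr \<Phi> h) \<boxtimes>\<^bsub>B\<^esub> on_comp \<Phi> g f)
        \<star>\<^bsub>B\<^esub> associator B (on_arr \<Phi> h) (on_arr \<Phi> g) (on_arr \<Phi> f)"
    and on_lunitor: "f \<in> hom1 M U V \<Longrightarrow>
      on_cell \<Phi> (lunitor M f) \<star>\<^bsub>B\<^esub> on_comp \<Phi> (id1 M V) f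
        \<star>\<^bsub>B\<^esub> (on_unit \<Phi> V \<boxtimes>\<^bsub>B\<^esub> id2 B (on_arr \<Phi> f))
      = lunitor B (on_arr \<Phi> f)"
    and on_runitor: "f \<in> hom1 M U V \<Longrightarrow>
      on_cell \<Phi> (runitor M f) \<star>\<^bsub>B\<^esub> on_comp \<Phi> f (id1 M U)
        \<star>\<^bsub>B\<^esub> (id2 B (on_arr \<Phi> f) \<boxtimes>\<^bsub>B\<^esub> on_unit \<Phi> U)
      = runitor B (on_arr \<Phi> f)"

text \<open>
  Equality of two homomorphisms out of \<open>M\<close>: their components are total functions, whose values
  outside the carriers of \<open>M\<close> are irrelevant.
\<close>

definition eq_hom ::
  "('o, 'm, 'c) bicat \<Rightarrow> ('o, 'm, 'c, 'p, 'n, 'd) bimorphism \<Rightarrow>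
   ('o, 'm, 'c, 'p, 'n, 'd) bimorphism \<Rightarrow> bool" where
  "eq_hom M \<Phi> \<Psi> \<longleftrightarrow>
     (\<forall>A \<in> objs M. on_obj \<Phi> A = on_obj \<Psi> A) \<and>
     (\<forall>f \<in> arrs M. on_arr \<Phi> f = on_arr \<Psi> f) \<and>
     (\<forall>\<alpha> \<in> cells M. on_cell \<Phi> \<alpha> = on_cell \<Psi> \<alpha>) \<and>
     (\<forall>f \<in> arrs M. \<forall>g \<in> arrs M. src M g = trg M f \<longrightarrow> on_comp \<Phi> g f = on_comp \<Psi> g f) \<and>
     (\<forall>A \<in> objs M. on_unit \<Phi> A = on_unit \<Psi> A)"

definition id_hom :: "('o, 'm, 'c) bicat \<Rightarrow> ('o, 'm, 'c, 'o, 'm, 'c) bimorphism" where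
  "id_hom M = \<lparr>
     on_obj = (\<lambda>A. A),
     on_arr = (\<lambda>f. f),
     on_cell = (\<lambda>\<alpha>. \<alpha>),
     on_comp = (\<lambda>g f. id2 M (g \<otimes>\<^bsub>M\<^esub> f)),
     on_unit = (\<lambda>A. id2 M (id1 M A)) \<rparr>"

definition comp_hom ::
  "('q, 'l, 'e) bicat \<Rightarrow> ('p, 'n, 'd, 'q, 'l, 'e) bimorphism \<Rightarrow>
   ('o, 'm, 'c, 'p, 'n, 'd) bimorphism \<Rightarrow> ('o, 'm, 'c, 'q, 'l, 'e) bimorphism" where
  "comp_hom C \<Psi> \<Phi> = \<lparr>
     on_obj = (\<lambda>A. on_obj \<Psi> (on_obj \<Phi> A)),
     on_arr = (\<lambda>f. on_arr \<Psi> (on_arr \<Phi> f)),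
     on_cell = (\<lambda>\<alpha>. on_cell \<Psi> (on_cell \<Phi> \<alpha>)),
     on_comp = (\<lambda>g f. on_cell \<Psi> (on_comp \<Phi> g f) \<star>\<^bsub>C\<^esub> on_comp \<Psi> (on_arr \<Phi> g) (on_arr \<Phi> f)),
     on_unit = (\<lambda>A. on_cell \<Psi> (on_unit \<Phi> A) \<star>\<^bsub>C\<^esub> on_unit \<Psi> (on_obj \<Phi> A)) \<rparr>"


section \<open>Pseudonatural equivalences and biequivalences\<close>

definition equivalence1 :: "('o, 'm, 'c) bicat \<Rightarrow> 'm \<Rightarrow> bool" where
  "equivalence1 B f \<longleftrightarrow> f \<in> arrs B \<and>
     (\<exists>g \<in> hom1 B (trg B f) (src B f).
        (\<exists>\<eta> \<in> hom2 B (id1 B (src B f)) (g \<otimes>\<^bsub>B\<^esub> f). invertible2 B \<eta>) \<and>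
        (\<exists>\<epsilon> \<in> hom2 B (f \<otimes>\<^bsub>B\<^esub> g) (id1 B (trg B f)). invertible2 B \<epsilon>))"

text \<open>
  A pseudonatural transformation \<open>\<Phi> \<Rightarrow> \<Psi>\<close> with components \<open>s A : \<Phi> A \<rightarrow> \<Psi> A\<close> and invertible
  \<open>t f : \<Psi> f \<otimes> s A \<rightarrow> s A' \<otimes> \<Phi> f\<close> for \<open>f : A \<rightarrow> A'\<close>.
\<close>

locale pseudonatural_transformation = \<Phi>: homomorphism M B \<Phi> + \<Psi>: homomorphism M B \<Psi>
  for M :: "('o, 'm, 'c) bicat" and B :: "('p, 'n, 'd) bicat"
    and \<Phi> \<Psi> :: "('o, 'm, 'c, 'p, 'n, 'd) bimorphism" +
  fixes s :: "'o \<Rightarrow> 'n" and t :: "'m \<Rightarrow> 'd"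
  assumes component_in_hom1: "A \<in> objs M \<Longrightarrow> s A \<in> hom1 B (on_obj \<Phi> A) (on_obj \<Psi> A)"
    and component_in_hom2: "f \<in> hom1 M U V \<Longrightarrow>
      t f \<in> hom2 B (on_arr \<Psi> f \<otimes>\<^bsub>B\<^esub> s U) (s V \<otimes>\<^bsub>B\<^esub> on_arr \<Phi> f)"
    and component_invertible: "f \<in> arrs M \<Longrightarrow> invertible2 B (t f)"
    and component_natural: "f \<in> hom1 M U V \<Longrightarrow> \<alpha> \<in> hom2 M f g \<Longrightarrow>
      (id2 B (s V) \<boxtimes>\<^bsub>B\<^esub> on_cell \<Phi> \<alpha>) \<star>\<^bsub>B\<^esub> t f = t g \<star>\<^bsub>B\<^esub> (on_cell \<Psi> \<alpha> \<boxtimes>\<^bsub>B\<^esub> id2 B (s U))"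
    and component_comp: "f \<in> hom1 M U V \<Longrightarrow> g \<in> hom1 M V W \<Longrightarrow>
      t (g \<otimes>\<^bsub>M\<^esub> f) \<star>\<^bsub>B\<^esub> (on_comp \<Psi> g f \<boxtimes>\<^bsub>B\<^esub> id2 B (s U))
      = (id2 B (s W) \<boxtimes>\<^bsub>B\<^esub> on_comp \<Phi> g f)
        \<star>\<^bsub>B\<^esub> associator B (s W) (on_arr \<Phi> g) (on_arr \<Phi> f)
        \<star>\<^bsub>B\<^esub> (t g \<boxtimes>\<^bsub>B\<^esub> id2 B (on_arr \<Phi> f))
        \<star>\<^bsub>B\<^esub> inv2 B (associator B (on_arr \<Psi> g) (s V) (on_arr \<Phi> f))
        \<star>\<^bsub>B\<^esub> (id2 B (on_arr \<Psi> g) \<boxtimes>\<^bsub>B\<^esub> t f)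
        \<star>\<^bsub>B\<^esub> associator B (on_arr \<Psi> g) (on_arr \<Psi> f) (s U)"
    and component_unit: "A \<in> objs M \<Longrightarrow>
      t (id1 M A) \<star>\<^bsub>B\<^esub> (on_unit \<Psi> A \<boxtimes>\<^bsub>B\<^esub> id2 B (s A))
      = (id2 B (s A) \<boxtimes>\<^bsub>B\<^esub> on_unit \<Phi> A) \<star>\<^bsub>B\<^esub> inv2 B (runitor B (s A)) \<star>\<^bsub>B\<^esub> lunitor B (s A)"

definition pseudonaturally_equivalent ::
  "('o, 'm, 'c) bicat \<Rightarrow> ('p, 'n, 'd) bicat \<Rightarrow> ('o, 'm, 'c, 'p, 'n, 'd) bimorphism \<Rightarrow>
   ('o, 'm, 'c, 'p, 'n, 'd) bimorphism \<Rightarrow> bool" where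
  "pseudonaturally_equivalent M B \<Phi> \<Psi> \<longleftrightarrow>
     (\<exists>s t. pseudonatural_transformation M B \<Phi> \<Psi> s t \<and> (\<forall>A \<in> objs M. equivalence1 B (s A)))"

definition biequivalence ::
  "('o, 'm, 'c) bicat \<Rightarrow> ('p, 'n, 'd) bicat \<Rightarrow> ('o, 'm, 'c, 'p, 'n, 'd) bimorphism \<Rightarrow> bool" where
  "biequivalence M B E \<longleftrightarrow> homomorphism M B E \<and>
     (\<exists>G. homomorphism B M G \<and>
          pseudonaturally_equivalent M M (comp_hom M G E) (id_hom M) \<and>
          pseudonaturally_equivalent B B (comp_hom B E G) (id_hom B))"


section \<open>Bases of enrichment\<close>

locale base_of_enrichment = bicategory M
  for M :: "('o, 'm, 'c) bicat" (structure) +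
  fixes \<W> :: "'c set"
  assumes weq_subset: "\<W> \<subseteq> cells M"
    and invertible_weq: "invertible2 M \<alpha> \<Longrightarrow> \<alpha> \<in> \<W>"
    and weq_vcomp: "\<alpha> \<in> hom2 M f g \<Longrightarrow> \<beta> \<in> hom2 M g h \<Longrightarrow> \<alpha> \<in> \<W> \<Longrightarrow> \<beta> \<in> \<W> \<Longrightarrow> \<beta> \<star> \<alpha> \<in> \<W>"
    and weq_cancel_left: "\<alpha> \<in> hom2 M f g \<Longrightarrow> \<beta> \<in> hom2 M g h \<Longrightarrow> \<beta> \<in> \<W> \<Longrightarrow> \<beta> \<star> \<alpha> \<in> \<W> \<Longrightarrow> \<alpha> \<in> \<W>"
    and weq_cancel_right: "\<alpha> \<in> hom2 M f g \<Longrightarrow> \<beta> \<in> hom2 M g h \<Longrightarrow> \<alpha> \<in> \<W> \<Longrightarrow> \<beta> \<star> \<alpha> \<in> \<W> \<Longrightarrow> \<beta> \<in> \<W>"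
    and weq_hcomp: "\<alpha> \<in> hom2 M f f' \<Longrightarrow> \<beta> \<in> hom2 M g g' \<Longrightarrow> src M g = trg M f \<Longrightarrow>
      \<alpha> \<in> \<W> \<Longrightarrow> \<beta> \<in> \<W> \<Longrightarrow> \<beta> \<boxtimes> \<alpha> \<in> \<W>"

definition makes_invertible ::
  "'c set \<Rightarrow> ('p, 'n, 'd) bicat \<Rightarrow> ('o, 'm, 'c, 'p, 'n, 'd) bimorphism \<Rightarrow> bool" where
  "makes_invertible \<W> B \<Phi> \<longleftrightarrow> (\<forall>\<alpha> \<in> \<W>. invertible2 B (on_cell \<Phi> \<alpha>))"

text \<open>
  The universal property of a homomorphism \<open>L : M \<rightarrow> N\<close> tested against one bicategory \<open>B\<close>:
  existence of factorizations through \<open>L\<close>, and their uniqueness up to pseudonatural equivalence.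
  Existence alone does not determine \<open>N\<close> up to biequivalence: adjoining an isolated object to \<open>N\<close>
  preserves it, as soon as \<open>M\<close> has an object.
\<close>

definition factorizations_exist ::
  "('o, 'm, 'c) bicat \<Rightarrow> 'c set \<Rightarrow> ('p, 'n, 'd) bicat \<Rightarrow> ('o, 'm, 'c, 'p, 'n, 'd) bimorphism \<Rightarrow>
   ('q, 'l, 'e) bicat \<Rightarrow> bool" where
  "factorizations_exist M \<W> N L B \<longleftrightarrow>
     (\<forall>\<Phi>. homomorphism M B \<Phi> \<and> makes_invertible \<W> B \<Phi> \<longrightarrow>
          (\<exists>\<Phi>'. homomorphism N B \<Phi>' \<and> eq_hom M \<Phi> (comp_hom B \<Phi>' L)))"

definition factorizations_unique ::
  "('o, 'm, 'c) bicat \<Rightarrow> ('p, 'n, 'd) bicat \<Rightarrow> ('o, 'm, 'c, 'p, 'n, 'd) bimorphism \<Rightarrow>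
   ('q, 'l, 'e) bicat \<Rightarrow> bool" where
  "factorizations_unique M N L B \<longleftrightarrow>
     (\<forall>\<Phi>\<^sub>1 \<Phi>\<^sub>2. homomorphism N B \<Phi>\<^sub>1 \<and> homomorphism N B \<Phi>\<^sub>2 \<and>
          eq_hom M (comp_hom B \<Phi>\<^sub>1 L) (comp_hom B \<Phi>\<^sub>2 L) \<longrightarrow>
          pseudonaturally_equivalent N B \<Phi>\<^sub>1 \<Phi>\<^sub>2)"


section \<open>The localization of a base of enrichment\<close>

text \<open>
  Each category \<open>M(U,V)\<close> is replaced by its Gabriel-Zisman localization at the 2-cells of \<open>\<W>\<close>
  that it contains; the objects and the 1-cells remain the same.  The construction is made
  explicit, rather than hidden behind an existential quantifier, because a formula of HOL cannot
  quantify over the types of the test bicategories within the scope of that quantifier.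

  A zigzag \<open>(f, xs, g)\<close> from \<open>f\<close> to \<open>g\<close> is a list of steps, the first step being the head:
  \<open>Fwd \<alpha>\<close> traverses \<open>\<alpha>\<close> from its domain to its codomain and \<open>Bwd w\<close>, with \<open>w \<in> \<W>\<close>, traverses \<open>w\<close>
  in the opposite direction.
\<close>

datatype 'c step = Fwd 'c | Bwd 'c

type_synonym ('m, 'c) zigzag = "'m \<times> 'c step list \<times> 'm"

fun path :: "('o, 'm, 'c) bicat \<Rightarrow> 'c set \<Rightarrow> 'm \<Rightarrow> 'c step list \<Rightarrow> 'm \<Rightarrow> bool" where
  "path M \<W> f [] g \<longleftrightarrow> f \<in> arrs M \<and> g = f"
| "path M \<W> f (Fwd \<alpha> # xs) g \<longleftrightarrow> \<alpha> \<in> cells M \<and> dom2 M \<alpha> = f \<and> path M \<W> (cod2 M \<alpha>) xs g"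
| "path M \<W> f (Bwd w # xs) g \<longleftrightarrow> w \<in> \<W> \<and> cod2 M w = f \<and> path M \<W> (dom2 M w) xs g"

definition zigzags :: "('o, 'm, 'c) bicat \<Rightarrow> 'c set \<Rightarrow> ('m, 'c) zigzag set" where
  "zigzags M \<W> = {(f, xs, g). path M \<W> f xs g}"

inductive zigzag_eq ::
  "('o, 'm, 'c) bicat \<Rightarrow> 'c set \<Rightarrow> ('m, 'c) zigzag \<Rightarrow> ('m, 'c) zigzag \<Rightarrow> bool"
  for M :: "('o, 'm, 'c) bicat" and \<W> :: "'c set" where
  refl: "z \<in> zigzags M \<W> \<Longrightarrow> zigzag_eq M \<W> z z"
| sym: "zigzag_eq M \<W> z z' \<Longrightarrow> zigzag_eq M \<W> z' z"
| trans: "zigzag_eq M \<W> z z' \<Longrightarrow> zigzag_eq M \<W> z' z'' \<Longrightarrow> zigzag_eq M \<W> z z''"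
| vcomp: "path M \<W> f (xs @ [Fwd \<alpha>, Fwd \<beta>] @ ys) g \<Longrightarrow>
    zigzag_eq M \<W> (f, xs @ [Fwd \<alpha>, Fwd \<beta>] @ ys, g) (f, xs @ [Fwd (\<beta> \<star>\<^bsub>M\<^esub> \<alpha>)] @ ys, g)"
| id2: "h \<in> arrs M \<Longrightarrow> path M \<W> f (xs @ [Fwd (id2 M h)] @ ys) g \<Longrightarrow>
    zigzag_eq M \<W> (f, xs @ [Fwd (id2 M h)] @ ys, g) (f, xs @ ys, g)"
| fwd_bwd: "path M \<W> f (xs @ [Fwd w, Bwd w] @ ys) g \<Longrightarrow>
    zigzag_eq M \<W> (f, xs @ [Fwd w, Bwd w] @ ys, g) (f, xs @ ys, g)"
| bwd_fwd: "path M \<W> f (xs @ [Bwd w, Fwd w] @ ys) g \<Longrightarrow>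
    zigzag_eq M \<W> (f, xs @ [Bwd w, Fwd w] @ ys, g) (f, xs @ ys, g)"

definition zigzag_class ::
  "('o, 'm, 'c) bicat \<Rightarrow> 'c set \<Rightarrow> ('m, 'c) zigzag \<Rightarrow> ('m, 'c) zigzag set" where
  "zigzag_class M \<W> z = {z'. zigzag_eq M \<W> z z'}"

text \<open>The image of a 2-cell of \<open>M\<close> in the localization.\<close>

definition fwd_class ::
  "('o, 'm, 'c) bicat \<Rightarrow> 'c set \<Rightarrow> 'c \<Rightarrow> ('m, 'c) zigzag set" where
  "fwd_class M \<W> \<alpha> = zigzag_class M \<W> (dom2 M \<alpha>, [Fwd \<alpha>], cod2 M \<alpha>)"

text \<open>
  Vertical composition is concatenation.  The horizontal composite of \<open>xs : f \<rightarrow> f'\<close> and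
  \<open>ys : g \<rightarrow> g'\<close> is the zigzag \<open>g \<otimes> f \<rightarrow> g' \<otimes> f \<rightarrow> g' \<otimes> f'\<close> obtained by whiskering \<open>ys\<close> with \<open>f\<close> and
  then \<open>xs\<close> with \<open>g'\<close>.
\<close>

definition localization ::
  "('o, 'm, 'c) bicat \<Rightarrow> 'c set \<Rightarrow> ('o, 'm, ('m, 'c) zigzag set) bicat" where
  "localization M \<W> = \<lparr>
     objs = objs M,
     arrs = arrs M,
     cells = zigzag_class M \<W> ` zigzags M \<W>,
     src = src M,
     trg = trg M,
     dom2 = (\<lambda>X. the_elem ((\<lambda>(f, xs, g). f) ` X)),
     cod2 = (\<lambda>X. the_elem ((\<lambda>(f, xs, g). g) ` X)),
     id1 = id1 M,
     comp1 = comp1 M,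
     id2 = (\<lambda>f. zigzag_class M \<W> (f, [], f)),
     vcomp = (\<lambda>Y X. \<Union>{zigzag_class M \<W> (f, xs @ ys, h) | f xs g ys h.
       (f, xs, g) \<in> X \<and> (g, ys, h) \<in> Y}),
     hcomp = (\<lambda>Y X. \<Union>{zigzag_class M \<W>
         (g \<otimes>\<^bsub>M\<^esub> f,
          map (map_step (\<lambda>\<beta>. \<beta> \<boxtimes>\<^bsub>M\<^esub> id2 M f)) ys @ map (map_step (\<lambda>\<alpha>. id2 M g' \<boxtimes>\<^bsub>M\<^esub> \<alpha>)) xs,
          g' \<otimes>\<^bsub>M\<^esub> f') | f xs f' g ys g'.
       (f, xs, f') \<in> X \<and> (g, ys, g') \<in> Y}),
     associator = (\<lambda>h g f. fwd_class M \<W> (associator M h g f)),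
     lunitor = (\<lambda>f. fwd_class M \<W> (lunitor M f)),
     runitor = (\<lambda>f. fwd_class M \<W> (runitor M f)) \<rparr>"

definition localization_hom ::
  "('o, 'm, 'c) bicat \<Rightarrow> 'c set \<Rightarrow> ('o, 'm, 'c, 'o, 'm, ('m, 'c) zigzag set) bimorphism" where
  "localization_hom M \<W> = \<lparr>
     on_obj = (\<lambda>A. A),
     on_arr = (\<lambda>f. f),
     on_cell = fwd_class M \<W>,
     on_comp = (\<lambda>g f. fwd_class M \<W> (id2 M (g \<otimes>\<^bsub>M\<^esub> f))),
     on_unit = (\<lambda>A. fwd_class M \<W> (id2 M (id1 M A))) \<rparr>"

end

theory Submission
  imports Defs
begin

text \<open>
  The Gabriel-Zisman localization of each category \<open>M(U,V)\<close> is generated by the 2-cells of \<open>M\<close> and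
  formal inverses of the 2-cells of \<open>\<W>\<close>.  A square stays commutative when two opposite invertible
  sides are inverted, so every naturality statement (interchange, associator, unitors, comparison
  cells) has only to be verified on the images of 2-cells of \<open>M\<close>, one variable at a time.  The
  pentagon and the triangle are inherited from \<open>M\<close> because whiskering with 1-cells commutes with
  \<open>M \<rightarrow> \<W>\<^sup>-\<^sup>1M\<close>.  A homomorphism inverting \<open>\<W>\<close> is evaluated on zigzags.  Homomorphisms that agree on
  the image of \<open>M\<close> agree on the carriers, and are then pseudonaturally equivalent through unit
  1-cells, by Kelly's coherence laws for the unitors.
\<close>

section \<open>Calculus in a bicategory\<close>

text \<open>Horizontal composition of zigzags has to choose an order, \<open>g \<otimes> f
  \<rightarrow> g' \<otimes> f \<rightarrow> g' \<otimes> f'\<close>, so interchange is not built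
  in: it amounts to exchanging two whiskered zigzags, and proving it takes naturality arguments
  inside the localization before the latter is known to be a bicategory. Hence the calculus of
  inverses is set up for the vertical structure alone, and the passage from 2-cells to zigzags is
  stated for functors from a single hom-category into any such structure. The target is sometimes
  the localization itself, sometimes an arbitrary \<open>B\<close>; with identity components the
  same principle shows that two homomorphisms agree on all cells. The localization keeps the
  1-cells, so a factorization can be strict: the extension has the same values on 1-cells and the
  same comparison cells as the given homomorphism. In a bicategory even the identity transformation
  has non-identity 2-cell components, the canonical isomorphisms
  \<open>f \<otimes> I \<rightarrow> I \<otimes> f\<close>; their compatibility with composition
  requires unit laws that are not among the axioms.\<close>

lemma hom1_iff: "f \<in> hom1 B U V \<longleftrightarrow> f \<in> arrs B \<and> src B f = U \<and> trg B f = V"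
  by (simp add: hom1_def)

lemma hom2_iff: "\<alpha> \<in> hom2 B f g \<longleftrightarrow> \<alpha> \<in> cells B \<and> dom2 B \<alpha> = f \<and> cod2 B \<alpha> = g"
  by (simp add: hom2_def)

text \<open>The category axioms of all hom-categories at once, separated from the horizontal
  structure: inverses and commuting squares in the localization are manipulated before its
  interchange law is available.\<close>

locale vertical_category =
  fixes B :: "('o, 'm, 'c) bicat" (structure)
  assumes dom2_arrs [simp]: "\<alpha> \<in> cells B \<Longrightarrow> dom2 B \<alpha> \<in> arrs B"
    and cod2_arrs [simp]: "\<alpha> \<in> cells B \<Longrightarrow> cod2 B \<alpha> \<in> arrs B"
    and id2_hom2: "f \<in> arrs B \<Longrightarrow> id2 B f \<in> hom2 B f f"
    and vcomp_hom2: "\<alpha> \<in> hom2 B f g \<Longrightarrow> \<beta> \<in> hom2 B g h \<Longrightarrow> \<beta> \<star> \<alpha> \<in> hom2 B f h"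
    and id2_vcomp: "\<alpha> \<in> hom2 B f g \<Longrightarrow> id2 B g \<star> \<alpha> = \<alpha>"
    and vcomp_id2: "\<alpha> \<in> hom2 B f g \<Longrightarrow> \<alpha> \<star> id2 B f = \<alpha>"
    and vcomp_vcomp: "\<alpha> \<in> hom2 B f g \<Longrightarrow> \<beta> \<in> hom2 B g h \<Longrightarrow> \<gamma> \<in> hom2 B h k \<Longrightarrow>
      (\<gamma> \<star> \<beta>) \<star> \<alpha> = \<gamma> \<star> (\<beta> \<star> \<alpha>)"
begin

lemma id2_simps [simp]:
  assumes "f \<in> arrs B"
  shows "id2 B f \<in> cells B" "dom2 B (id2 B f) = f" "cod2 B (id2 B f) = f"
  using id2_hom2[OF assms] by (auto simp: hom2_iff)

lemma vcomp_simps [simp]: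
  assumes "\<alpha> \<in> cells B" "\<beta> \<in> cells B" "dom2 B \<beta> = cod2 B \<alpha>"
  shows "\<beta> \<star> \<alpha> \<in> cells B" "dom2 B (\<beta> \<star> \<alpha>) = dom2 B \<alpha>" "cod2 B (\<beta> \<star> \<alpha>) = cod2 B \<beta>"
  using vcomp_hom2[of \<alpha> "dom2 B \<alpha>" "cod2 B \<alpha>" \<beta> "cod2 B \<beta>"] assms by (auto simp: hom2_iff)

lemma vcomp_id2_simps [simp]:
  assumes "\<alpha> \<in> cells B"
  shows "cod2 B \<alpha> = g \<Longrightarrow> id2 B g \<star> \<alpha> = \<alpha>" "dom2 B \<alpha> = f \<Longrightarrow> \<alpha> \<star> id2 B f = \<alpha>"
  using assms id2_vcomp vcomp_id2 by (auto simp: hom2_iff)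

lemma vcomp_assoc_simp [simp]:
  assumes "\<alpha> \<in> cells B" "\<beta> \<in> cells B" "\<gamma> \<in> cells B" "dom2 B \<beta> = cod2 B \<alpha>" "dom2 B \<gamma> = cod2 B \<beta>"
  shows "(\<gamma> \<star> \<beta>) \<star> \<alpha> = \<gamma> \<star> (\<beta> \<star> \<alpha>)"
  using vcomp_vcomp assms by (auto simp: hom2_iff)

text \<open>Simplification brackets vertical composites to the right, so a commuting square inside a
  longer composite carries a remainder \<xi>; in this form the square can be applied there. The
  domain of \<gamma> is read off from the equation.\<close>

lemma vcomp_eq_reassoc:
  assumes "\<beta> \<star> \<alpha> = \<delta> \<star> \<gamma>" "\<alpha> \<in> cells B" "\<beta> \<in> cells B" "dom2 B \<beta> = cod2 B \<alpha>"
    "\<gamma> \<in> cells B" "\<delta> \<in> cells B" "dom2 B \<delta> = cod2 B \<gamma>"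
    "\<xi> \<in> cells B" "cod2 B \<xi> = dom2 B \<alpha>"
  shows "\<beta> \<star> (\<alpha> \<star> \<xi>) = \<delta> \<star> (\<gamma> \<star> \<xi>)"
proof -
  have "dom2 B \<gamma> = dom2 B \<alpha>"
    using assms vcomp_simps(2) by metis
  then show ?thesis
    using assms vcomp_assoc_simp[of \<xi> \<alpha> \<beta>] vcomp_assoc_simp[of \<xi> \<gamma> \<delta>] by simp
qed

lemma inverse2_unique:
  assumes "inverse2 B \<alpha> \<beta>" "inverse2 B \<alpha> \<gamma>"
  shows "\<beta> = \<gamma>"
proof -
  have "\<beta> = (\<gamma> \<star> \<alpha>) \<star> \<beta>" using assms by (simp add: inverse2_def hom2_iff)
  also have "\<dots> = \<gamma> \<star> (\<alpha> \<star> \<beta>)" using assms by (intro vcomp_assoc_simp) (auto simp: inverse2_def hom2_iff)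
  also have "\<dots> = \<gamma>" using assms by (simp add: inverse2_def hom2_iff)
  finally show ?thesis .
qed

lemma inverse2_inv2: "invertible2 B \<alpha> \<Longrightarrow> inverse2 B \<alpha> (inv2 B \<alpha>)"
  unfolding invertible2_def inv2_def by (metis inverse2_unique theI)

lemma inv2_eqI: "inverse2 B \<alpha> \<beta> \<Longrightarrow> inv2 B \<alpha> = \<beta>"
  using inverse2_inv2 inverse2_unique invertible2_def by metis

lemma invertible2_cells [simp]: "invertible2 B \<alpha> \<Longrightarrow> \<alpha> \<in> cells B"
  by (auto simp: invertible2_def inverse2_def)

lemma inv2_simps [simp]:
  assumes "invertible2 B \<alpha>"
  shows "inv2 B \<alpha> \<in> cells B" "dom2 B (inv2 B \<alpha>) = cod2 B \<alpha>" "cod2 B (inv2 B \<alpha>) = dom2 B \<alpha>"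
    "inv2 B \<alpha> \<star> \<alpha> = id2 B (dom2 B \<alpha>)" "\<alpha> \<star> inv2 B \<alpha> = id2 B (cod2 B \<alpha>)"
  using inverse2_inv2[OF assms] by (auto simp: inverse2_def hom2_iff)

lemma inv2_cancel [simp]:
  assumes \<alpha>: "invertible2 B \<alpha>" and \<xi>: "\<xi> \<in> cells B"
  shows "cod2 B \<xi> = dom2 B \<alpha> \<Longrightarrow> inv2 B \<alpha> \<star> (\<alpha> \<star> \<xi>) = \<xi>"
    "cod2 B \<xi> = cod2 B \<alpha> \<Longrightarrow> \<alpha> \<star> (inv2 B \<alpha> \<star> \<xi>) = \<xi>"
proof -
  show "inv2 B \<alpha> \<star> (\<alpha> \<star> \<xi>) = \<xi>" if "cod2 B \<xi> = dom2 B \<alpha>"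
    by (subst vcomp_assoc_simp[symmetric]) (use \<alpha> \<xi> that in simp_all)
  show "\<alpha> \<star> (inv2 B \<alpha> \<star> \<xi>) = \<xi>" if "cod2 B \<xi> = cod2 B \<alpha>"
    by (subst vcomp_assoc_simp[symmetric]) (use \<alpha> \<xi> that in simp_all)
qed

lemma inverse2_sym: "inverse2 B \<alpha> \<beta> \<Longrightarrow> inverse2 B \<beta> \<alpha>"
  by (auto simp: inverse2_def hom2_iff)

lemma inverse2_invertible2: "inverse2 B \<alpha> \<beta> \<Longrightarrow> invertible2 B \<alpha>"
  by (auto simp: invertible2_def)

lemma invertible2_inv2 [simp]: "invertible2 B \<alpha> \<Longrightarrow> invertible2 B (inv2 B \<alpha>)"
  using inverse2_inv2 inverse2_sym inverse2_invertible2 by blast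

lemma invertible2_id2 [simp]: "f \<in> arrs B \<Longrightarrow> invertible2 B (id2 B f)"
  by (rule inverse2_invertible2[of _ "id2 B f"]) (simp add: inverse2_def hom2_iff)

lemma invertible2_vcomp [simp]:
  assumes "invertible2 B \<alpha>" "invertible2 B \<beta>" "dom2 B \<beta> = cod2 B \<alpha>"
  shows "invertible2 B (\<beta> \<star> \<alpha>)"
  by (rule inverse2_invertible2[of _ "inv2 B \<alpha> \<star> inv2 B \<beta>"])
    (use assms in \<open>simp add: inverse2_def hom2_iff\<close>)

lemma vcomp_left_cancel:
  assumes "\<iota> \<star> \<alpha> = \<iota> \<star> \<beta>" "invertible2 B \<iota>" "\<alpha> \<in> cells B" "\<beta> \<in> cells B"
    "cod2 B \<alpha> = dom2 B \<iota>" "cod2 B \<beta> = dom2 B \<iota>"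
  shows "\<alpha> = \<beta>"
  using assms inv2_cancel(1)[of \<iota>] by metis

lemma vcomp_right_cancel:
  assumes "\<alpha> \<star> \<iota> = \<beta> \<star> \<iota>" "invertible2 B \<iota>" "\<alpha> \<in> cells B" "\<beta> \<in> cells B"
    "dom2 B \<alpha> = cod2 B \<iota>" "dom2 B \<beta> = cod2 B \<iota>"
  shows "\<alpha> = \<beta>"
proof -
  have "\<alpha> = (\<alpha> \<star> \<iota>) \<star> inv2 B \<iota>" using assms(2-) by simp
  also have "\<dots> = (\<beta> \<star> \<iota>) \<star> inv2 B \<iota>" using assms(1) by simp
  also have "\<dots> = \<beta>" using assms(2-) by simp
  finally show ?thesis .
qed

text \<open>Composing the square with \<beta>' on the left and \<alpha>' on the right reverses it.
  This carries naturality from a 2-cell of \<open>\<W>\<close> to its formal inverse.\<close>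

lemma square_inverse:
  assumes "\<tau>' \<star> \<alpha> = \<beta> \<star> \<tau>" "inverse2 B \<alpha> \<alpha>'" "inverse2 B \<beta> \<beta>'"
    "\<tau> \<in> hom2 B (dom2 B \<alpha>) (dom2 B \<beta>)" "\<tau>' \<in> hom2 B (cod2 B \<alpha>) (cod2 B \<beta>)"
  shows "\<tau> \<star> \<alpha>' = \<beta>' \<star> \<tau>'"
proof -
  have inv: "\<alpha>' = inv2 B \<alpha>" "\<beta>' = inv2 B \<beta>" "invertible2 B \<alpha>" "invertible2 B \<beta>"
    using assms(2,3) by (auto simp: inv2_eqI inverse2_invertible2)
  then have "\<beta>' \<star> \<tau>' = \<beta>' \<star> ((\<tau>' \<star> \<alpha>) \<star> \<alpha>')"
    using assms(4,5) by (simp add: hom2_iff)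
  also have "\<dots> = \<beta>' \<star> ((\<beta> \<star> \<tau>) \<star> \<alpha>')"
    using assms(1) by simp
  also have "\<dots> = \<tau> \<star> \<alpha>'"
    using inv assms(4,5) by (simp add: hom2_iff)
  finally show ?thesis by simp
qed

end

sublocale bicategory \<subseteq> vertical_category
  by unfold_locales
    (auto intro: dom2_in_arrs cod2_in_arrs id2_in_hom2 vcomp_in_hom2 vcomp_id2_left vcomp_id2_right
      vcomp_assoc)

section \<open>Horizontal composition, constraint cells and Kelly's unit laws\<close>

context bicategory
begin

lemma src_trg_objs [simp]: "f \<in> arrs B \<Longrightarrow> src B f \<in> objs B" "f \<in> arrs B \<Longrightarrow> trg B f \<in> objs B"
  by (auto intro: src_in_objs trg_in_objs)

lemma src_trg_cod2 [simp]:
  assumes "\<alpha> \<in> cells B"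
  shows "src B (cod2 B \<alpha>) = src B (dom2 B \<alpha>)" "trg B (cod2 B \<alpha>) = trg B (dom2 B \<alpha>)"
  using assms src_dom2 trg_dom2 by auto

lemma id1_simps [simp]:
  assumes "U \<in> objs B"
  shows "id1 B U \<in> arrs B" "src B (id1 B U) = U" "trg B (id1 B U) = U"
  using id1_in_hom1[OF assms] by (auto simp: hom1_iff)

lemma comp1_simps [simp]:
  assumes "f \<in> arrs B" "g \<in> arrs B" "src B g = trg B f"
  shows "g \<otimes> f \<in> arrs B" "src B (g \<otimes> f) = src B f" "trg B (g \<otimes> f) = trg B g"
  using comp1_in_hom1[of f _ _ g] assms by (auto simp: hom1_iff)

lemma hcomp_simps [simp]:
  assumes "\<alpha> \<in> cells B" "\<beta> \<in> cells B" "src B (dom2 B \<beta>) = trg B (dom2 B \<alpha>)"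
  shows "\<beta> \<boxtimes> \<alpha> \<in> cells B" "dom2 B (\<beta> \<boxtimes> \<alpha>) = dom2 B \<beta> \<otimes> dom2 B \<alpha>"
    "cod2 B (\<beta> \<boxtimes> \<alpha>) = cod2 B \<beta> \<otimes> cod2 B \<alpha>"
  using hcomp_in_hom2[of \<alpha> _ _ \<beta>] assms by (auto simp: hom2_iff)

lemma hcomp_id2_simp [simp]:
  "f \<in> arrs B \<Longrightarrow> g \<in> arrs B \<Longrightarrow> src B g = trg B f \<Longrightarrow> id2 B g \<boxtimes> id2 B f = id2 B (g \<otimes> f)"
  using hcomp_id2[of f _ _ g] by (auto simp: hom1_iff)

lemma interchange':
  assumes "\<alpha> \<in> cells B" "\<alpha>' \<in> cells B" "dom2 B \<alpha>' = cod2 B \<alpha>"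
    "\<beta> \<in> cells B" "\<beta>' \<in> cells B" "dom2 B \<beta>' = cod2 B \<beta>" "src B (dom2 B \<beta>) = trg B (dom2 B \<alpha>)"
  shows "(\<beta>' \<boxtimes> \<alpha>') \<star> (\<beta> \<boxtimes> \<alpha>) = (\<beta>' \<star> \<beta>) \<boxtimes> (\<alpha>' \<star> \<alpha>)"
  using interchange[of \<alpha> _ _ \<alpha>' _ \<beta> _ _ \<beta>'] assms by (auto simp: hom2_iff)

lemma whisker_left_vcomp:
  assumes "\<alpha> \<in> cells B" "\<alpha>' \<in> cells B" "dom2 B \<alpha>' = cod2 B \<alpha>" "g \<in> arrs B" "src B g = trg B (dom2 B \<alpha>)"
  shows "id2 B g \<boxtimes> (\<alpha>' \<star> \<alpha>) = (id2 B g \<boxtimes> \<alpha>') \<star> (id2 B g \<boxtimes> \<alpha>)"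
  using assms by (simp add: interchange')

lemma whisker_right_vcomp:
  assumes "\<alpha> \<in> cells B" "\<alpha>' \<in> cells B" "dom2 B \<alpha>' = cod2 B \<alpha>" "f \<in> arrs B" "trg B f = src B (dom2 B \<alpha>)"
  shows "(\<alpha>' \<star> \<alpha>) \<boxtimes> id2 B f = (\<alpha>' \<boxtimes> id2 B f) \<star> (\<alpha> \<boxtimes> id2 B f)"
  using assms by (simp add: interchange')

lemma invertible2_hcomp [simp]:
  assumes "invertible2 B \<alpha>" "invertible2 B \<beta>" "src B (dom2 B \<beta>) = trg B (dom2 B \<alpha>)"
  shows "invertible2 B (\<beta> \<boxtimes> \<alpha>)"
  by (rule inverse2_invertible2[of _ "inv2 B \<beta> \<boxtimes> inv2 B \<alpha>"])
    (use assms in \<open>simp add: inverse2_def hom2_iff interchange'\<close>)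

lemma associator_simps [simp]:
  assumes "f \<in> arrs B" "g \<in> arrs B" "h \<in> arrs B" "src B g = trg B f" "src B h = trg B g"
  shows "associator B h g f \<in> cells B" "dom2 B (associator B h g f) = (h \<otimes> g) \<otimes> f"
    "cod2 B (associator B h g f) = h \<otimes> (g \<otimes> f)" "invertible2 B (associator B h g f)"
  using associator_in_hom2[of f _ _ g _ h] associator_invertible[of f _ _ g _ h] assms
  by (auto simp: hom1_iff hom2_iff)

lemma unitor_simps [simp]:
  assumes "f \<in> arrs B"
  shows "lunitor B f \<in> cells B" "dom2 B (lunitor B f) = id1 B (trg B f) \<otimes> f"
    "cod2 B (lunitor B f) = f" "invertible2 B (lunitor B f)"
    "runitor B f \<in> cells B" "dom2 B (runitor B f) = f \<otimes> id1 B (src B f)"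
    "cod2 B (runitor B f) = f" "invertible2 B (runitor B f)"
  using lunitor_in_hom2[of f] lunitor_invertible[of f] runitor_in_hom2[of f]
    runitor_invertible[of f] assms
  by (auto simp: hom1_iff hom2_iff)

lemma associator_natural':
  assumes "\<alpha> \<in> cells B" "\<beta> \<in> cells B" "\<gamma> \<in> cells B"
    "src B (dom2 B \<beta>) = trg B (dom2 B \<alpha>)" "src B (dom2 B \<gamma>) = trg B (dom2 B \<beta>)"
  shows "associator B (cod2 B \<gamma>) (cod2 B \<beta>) (cod2 B \<alpha>) \<star> ((\<gamma> \<boxtimes> \<beta>) \<boxtimes> \<alpha>)
    = (\<gamma> \<boxtimes> (\<beta> \<boxtimes> \<alpha>)) \<star> associator B (dom2 B \<gamma>) (dom2 B \<beta>) (dom2 B \<alpha>)"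
  using associator_natural[of \<alpha> _ _ \<beta> _ _ \<gamma>] assms by (auto simp: hom2_iff)

lemma lunitor_natural':
  "\<alpha> \<in> cells B \<Longrightarrow> lunitor B (cod2 B \<alpha>) \<star> (id2 B (id1 B (trg B (dom2 B \<alpha>))) \<boxtimes> \<alpha>)
    = \<alpha> \<star> lunitor B (dom2 B \<alpha>)"
  using lunitor_natural[of \<alpha>] by (auto simp: hom2_iff)

lemma runitor_natural':
  "\<alpha> \<in> cells B \<Longrightarrow> runitor B (cod2 B \<alpha>) \<star> (\<alpha> \<boxtimes> id2 B (id1 B (src B (dom2 B \<alpha>))))
    = \<alpha> \<star> runitor B (dom2 B \<alpha>)"
  using runitor_natural[of \<alpha>] by (auto simp: hom2_iff)

lemma triangle':
  "f \<in> arrs B \<Longrightarrow> g \<in> arrs B \<Longrightarrow> src B g = trg B f \<Longrightarrow>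
    (id2 B g \<boxtimes> lunitor B f) \<star> associator B g (id1 B (trg B f)) f = runitor B g \<boxtimes> id2 B f"
  using triangle[of f _ _ g] by (auto simp: hom1_iff)

lemma pentagon':
  assumes "f \<in> arrs B" "g \<in> arrs B" "h \<in> arrs B" "k \<in> arrs B"
    "src B g = trg B f" "src B h = trg B g" "src B k = trg B h"
  shows "(id2 B k \<boxtimes> associator B h g f) \<star> (associator B k (h \<otimes> g) f \<star> (associator B k h g \<boxtimes> id2 B f))
      = associator B k h (g \<otimes> f) \<star> associator B (k \<otimes> h) g f"
  using pentagon[of f _ _ g _ h _ k] assms by (simp add: hom1_iff)

text \<open>Whiskering with a unit 1-cell is faithful, being isomorphic to the identity.\<close>

lemma id1_whisker_left_cancel:
  assumes "id2 B (id1 B (trg B (dom2 B \<alpha>))) \<boxtimes> \<alpha> = id2 B (id1 B (trg B (dom2 B \<alpha>))) \<boxtimes> \<beta>"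
    "\<alpha> \<in> hom2 B f g" "\<beta> \<in> hom2 B f g"
  shows "\<alpha> = \<beta>"
proof (rule vcomp_right_cancel)
  show "\<alpha> \<star> lunitor B f = \<beta> \<star> lunitor B f"
    using lunitor_natural'[of \<alpha>] lunitor_natural'[of \<beta>] assms by (auto simp: hom2_iff)
qed (use assms in \<open>auto simp: hom2_iff\<close>)

lemma id1_whisker_right_cancel:
  assumes "\<alpha> \<boxtimes> id2 B (id1 B (src B (dom2 B \<alpha>))) = \<beta> \<boxtimes> id2 B (id1 B (src B (dom2 B \<alpha>)))"
    "\<alpha> \<in> hom2 B f g" "\<beta> \<in> hom2 B f g"
  shows "\<alpha> = \<beta>"
proof (rule vcomp_right_cancel)
  show "\<alpha> \<star> runitor B f = \<beta> \<star> runitor B f"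
    using runitor_natural'[of \<alpha>] runitor_natural'[of \<beta>] assms by (auto simp: hom2_iff)
qed (use assms in \<open>auto simp: hom2_iff\<close>)

text \<open>One of Kelly's laws. The equation is tested after whiskering with the unit
  \<open>I\<close> on the left, where the pentagon for \<open>f\<close>, \<open>g\<close>,
  \<open>I\<close>, \<open>I\<close> and two triangles apply; the invertible associators are then
  cancelled, and whiskering with \<open>I\<close> is faithful.\<close>

lemma lunitor_comp1:
  assumes f: "f \<in> arrs B" and g: "g \<in> arrs B" and gf: "src B g = trg B f"
  shows "lunitor B (g \<otimes> f) \<star> associator B (id1 B (trg B g)) g f = lunitor B g \<boxtimes> id2 B f"
proof -
  define I where "I = id1 B (trg B g)"
  have I: "I \<in> arrs B" "src B I = trg B g" "trg B I = trg B g" using g by (auto simp: I_def)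
  note [simp] = f g gf I
  have "(id2 B I \<boxtimes> (lunitor B (g \<otimes> f) \<star> associator B I g f)) \<star>
        (associator B I (I \<otimes> g) f \<star> (associator B I I g \<boxtimes> id2 B f))
      = (id2 B I \<boxtimes> lunitor B (g \<otimes> f)) \<star> ((id2 B I \<boxtimes> associator B I g f) \<star>
        (associator B I (I \<otimes> g) f \<star> (associator B I I g \<boxtimes> id2 B f)))"
    by (simp add: whisker_left_vcomp I_def[symmetric])
  also have "\<dots> = (id2 B I \<boxtimes> lunitor B (g \<otimes> f)) \<star> (associator B I I (g \<otimes> f) \<star> associator B (I \<otimes> I) g f)"
    by (simp add: pentagon')
  \<comment> \<open>A triangle trades the left unitor for \<open>runitor B I\<close>, which
    naturality of the associator can move across \<open>g\<close> and \<open>f\<close>; a second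
    triangle then trades it back.\<close>
  also have "\<dots> = (runitor B I \<boxtimes> id2 B (g \<otimes> f)) \<star> associator B (I \<otimes> I) g f"
    using triangle'[of "g \<otimes> f" I] vcomp_assoc_simp[symmetric, of "associator B (I \<otimes> I) g f" "associator B I I (g \<otimes> f)" "id2 B I \<boxtimes> lunitor B (g \<otimes> f)"]
    by (simp add: I_def[symmetric])
  also have "\<dots> = associator B I g f \<star> ((runitor B I \<boxtimes> id2 B g) \<boxtimes> id2 B f)"
    using associator_natural'[of "id2 B f" "id2 B g" "runitor B I"] by (simp add: I_def)
  also have "\<dots> = associator B I g f \<star> (((id2 B I \<boxtimes> lunitor B g) \<boxtimes> id2 B f) \<star> (associator B I I g \<boxtimes> id2 B f))"
    using triangle'[of g I] by (simp add: I_def interchange')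
  also have "\<dots> = (id2 B I \<boxtimes> (lunitor B g \<boxtimes> id2 B f)) \<star>
      (associator B I (I \<otimes> g) f \<star> (associator B I I g \<boxtimes> id2 B f))"
    using associator_natural'[of "id2 B f" "lunitor B g" "id2 B I"]
    by (intro vcomp_eq_reassoc) (auto simp: I_def)
  finally have eq: "id2 B I \<boxtimes> (lunitor B (g \<otimes> f) \<star> associator B I g f) = id2 B I \<boxtimes> (lunitor B g \<boxtimes> id2 B f)"
    by (rule vcomp_right_cancel) (auto simp: I_def[symmetric])
  have "lunitor B (g \<otimes> f) \<star> associator B I g f = lunitor B g \<boxtimes> id2 B f"
    by (rule id1_whisker_left_cancel[of _ _ "(I \<otimes> g) \<otimes> f" "g \<otimes> f"])
      (use eq in \<open>simp_all add: I_def[symmetric] hom2_iff\<close>)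
  then show ?thesis by (simp add: I_def)
qed

text \<open>The mirror image: whiskering is with \<open>I\<close> on the right, the pentagon is
  taken for \<open>I\<close>, \<open>I\<close>, \<open>f\<close>, \<open>g\<close>, and the
  associator to be cancelled at the end stands on the left.\<close>

lemma runitor_comp1:
  assumes f: "f \<in> arrs B" and g: "g \<in> arrs B" and gf: "src B g = trg B f"
  shows "(id2 B g \<boxtimes> runitor B f) \<star> associator B g f (id1 B (src B f)) = runitor B (g \<otimes> f)"
proof -
  define I where "I = id1 B (src B f)"
  have I: "I \<in> arrs B" "src B I = src B f" "trg B I = src B f" using f by (auto simp: I_def)
  note [simp] = f g gf I
  have tri: "runitor B f \<boxtimes> id2 B I = (id2 B f \<boxtimes> lunitor B I) \<star> associator B f I I"
    using triangle'[of I f] by (simp add: I_def[symmetric])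
  have "associator B g f I \<star> (((id2 B g \<boxtimes> runitor B f) \<star> associator B g f I) \<boxtimes> id2 B I)
     = associator B g f I \<star> (((id2 B g \<boxtimes> runitor B f) \<boxtimes> id2 B I) \<star> (associator B g f I \<boxtimes> id2 B I))"
    by (simp add: whisker_right_vcomp I_def[symmetric])
  also have "\<dots> = (id2 B g \<boxtimes> (runitor B f \<boxtimes> id2 B I)) \<star>
      (associator B g (f \<otimes> I) I \<star> (associator B g f I \<boxtimes> id2 B I))"
    using associator_natural'[of "id2 B I" "runitor B f" "id2 B g"]
    by (intro vcomp_eq_reassoc) (auto simp: I_def)
  also have "\<dots> = (id2 B g \<boxtimes> (id2 B f \<boxtimes> lunitor B I)) \<star> ((id2 B g \<boxtimes> associator B f I I) \<star>
      (associator B g (f \<otimes> I) I \<star> (associator B g f I \<boxtimes> id2 B I)))"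
    by (simp add: tri whisker_left_vcomp I_def[symmetric])
  also have "\<dots> = (id2 B g \<boxtimes> (id2 B f \<boxtimes> lunitor B I)) \<star> (associator B g f (I \<otimes> I) \<star> associator B (g \<otimes> f) I I)"
    by (simp add: pentagon')
  also have "\<dots> = associator B g f I \<star> ((id2 B (g \<otimes> f) \<boxtimes> lunitor B I) \<star> associator B (g \<otimes> f) I I)"
    using associator_natural'[of "lunitor B I" "id2 B f" "id2 B g"]
    by (intro vcomp_eq_reassoc) (auto simp: I_def)
  also have "\<dots> = associator B g f I \<star> (runitor B (g \<otimes> f) \<boxtimes> id2 B I)"
    using triangle'[of I "g \<otimes> f"] by (simp add: I_def)
  finally have eq: "((id2 B g \<boxtimes> runitor B f) \<star> associator B g f I) \<boxtimes> id2 B I = runitor B (g \<otimes> f) \<boxtimes> id2 B I"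
    by (rule vcomp_left_cancel) (auto simp: I_def[symmetric])
  have "(id2 B g \<boxtimes> runitor B f) \<star> associator B g f I = runitor B (g \<otimes> f)"
    by (rule id1_whisker_right_cancel[of _ _ "(g \<otimes> f) \<otimes> I" "g \<otimes> f"])
      (use eq in \<open>simp_all add: I_def[symmetric] hom2_iff\<close>)
  then show ?thesis by (simp add: I_def)
qed

text \<open>Naturality of the left unitor at itself gives
  \<open>lunitor B (I \<otimes> I) = id2 B I \<boxtimes> lunitor B I\<close>, since
  \<open>lunitor B I\<close> can be cancelled. Kelly's law and the triangle then identify the two
  unitors after whiskering with \<open>I\<close>.\<close>

lemma lunitor_id1_eq_runitor_id1:
  assumes [simp]: "U \<in> objs B"
  shows "lunitor B (id1 B U) = runitor B (id1 B U)"
proof -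
  define I where "I = id1 B U"
  have [simp]: "I \<in> arrs B" "src B I = U" "trg B I = U" by (auto simp: I_def)
  have "lunitor B (I \<otimes> I) = id2 B I \<boxtimes> lunitor B I"
    by (rule vcomp_left_cancel[of "lunitor B I"])
      (use lunitor_natural'[of "lunitor B I"] in \<open>auto simp: I_def[symmetric]\<close>)
  then have "lunitor B I \<boxtimes> id2 B I = runitor B I \<boxtimes> id2 B I"
    using lunitor_comp1[of I I] triangle'[of I I] by (simp add: I_def[symmetric])
  then show ?thesis
    using id1_whisker_right_cancel[of "lunitor B I" "runitor B I" "I \<otimes> I" I]
    by (auto simp: hom2_iff I_def[symmetric])
qed

end

section \<open>Homomorphisms\<close>

context homomorphism
begin

lemma on_obj_simp [simp]: "A \<in> objs M \<Longrightarrow> on_obj \<Phi> A \<in> objs B"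
  by (rule on_obj_in_objs)

lemma on_arr_simps [simp]:
  assumes "f \<in> arrs M"
  shows "on_arr \<Phi> f \<in> arrs B" "src B (on_arr \<Phi> f) = on_obj \<Phi> (src M f)"
    "trg B (on_arr \<Phi> f) = on_obj \<Phi> (trg M f)"
  using on_arr_in_hom1[of f] assms by (auto simp: hom1_iff)

lemma on_cell_simps [simp]:
  assumes "\<alpha> \<in> cells M"
  shows "on_cell \<Phi> \<alpha> \<in> cells B" "dom2 B (on_cell \<Phi> \<alpha>) = on_arr \<Phi> (dom2 M \<alpha>)"
    "cod2 B (on_cell \<Phi> \<alpha>) = on_arr \<Phi> (cod2 M \<alpha>)"
  using on_cell_in_hom2[of \<alpha>] assms by (auto simp: hom2_iff)

declare on_cell_id2 [simp]

lemma on_cell_vcomp_simp [simp]: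
  "\<alpha> \<in> cells M \<Longrightarrow> \<beta> \<in> cells M \<Longrightarrow> dom2 M \<beta> = cod2 M \<alpha> \<Longrightarrow>
    on_cell \<Phi> (\<beta> \<star>\<^bsub>M\<^esub> \<alpha>) = on_cell \<Phi> \<beta> \<star>\<^bsub>B\<^esub> on_cell \<Phi> \<alpha>"
  by (rule on_cell_vcomp) (auto simp: hom2_iff)

lemma on_comp_simps [simp]:
  assumes "f \<in> arrs M" "g \<in> arrs M" "src M g = trg M f"
  shows "on_comp \<Phi> g f \<in> cells B" "dom2 B (on_comp \<Phi> g f) = on_arr \<Phi> g \<otimes>\<^bsub>B\<^esub> on_arr \<Phi> f"
    "cod2 B (on_comp \<Phi> g f) = on_arr \<Phi> (g \<otimes>\<^bsub>M\<^esub> f)" "invertible2 B (on_comp \<Phi> g f)"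
  using on_comp_in_hom2[of f _ _ g] on_comp_invertible[of f _ _ g] assms
  by (auto simp: hom1_iff hom2_iff)

lemma on_unit_simps [simp]:
  assumes "A \<in> objs M"
  shows "on_unit \<Phi> A \<in> cells B" "dom2 B (on_unit \<Phi> A) = id1 B (on_obj \<Phi> A)"
    "cod2 B (on_unit \<Phi> A) = on_arr \<Phi> (id1 M A)" "invertible2 B (on_unit \<Phi> A)"
  using on_unit_in_hom2[of A] on_unit_invertible[of A] assms by (auto simp: hom2_iff)

lemma on_comp_natural':
  assumes "\<alpha> \<in> cells M" "\<beta> \<in> cells M" "src M (dom2 M \<beta>) = trg M (dom2 M \<alpha>)"
  shows "on_comp \<Phi> (cod2 M \<beta>) (cod2 M \<alpha>) \<star>\<^bsub>B\<^esub> (on_cell \<Phi> \<beta> \<boxtimes>\<^bsub>B\<^esub> on_cell \<Phi> \<alpha>)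
      = on_cell \<Phi> (\<beta> \<boxtimes>\<^bsub>M\<^esub> \<alpha>) \<star>\<^bsub>B\<^esub> on_comp \<Phi> (dom2 M \<beta>) (dom2 M \<alpha>)"
  using on_comp_natural[of \<alpha> _ _ \<beta>] assms by (auto simp: hom2_iff)

lemma on_associator':
  assumes "f \<in> arrs M" "g \<in> arrs M" "h \<in> arrs M" "src M g = trg M f" "src M h = trg M g"
  shows "on_cell \<Phi> (associator M h g f) \<star>\<^bsub>B\<^esub> (on_comp \<Phi> (h \<otimes>\<^bsub>M\<^esub> g) f
        \<star>\<^bsub>B\<^esub> (on_comp \<Phi> h g \<boxtimes>\<^bsub>B\<^esub> id2 B (on_arr \<Phi> f)))
      = on_comp \<Phi> h (g \<otimes>\<^bsub>M\<^esub> f) \<star>\<^bsub>B\<^esub> ((id2 B (on_arr \<Phi> h) \<boxtimes>\<^bsub>B\<^esub> on_comp \<Phi> g f)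
        \<star>\<^bsub>B\<^esub> associator B (on_arr \<Phi> h) (on_arr \<Phi> g) (on_arr \<Phi> f))"
  using on_associator[of f _ _ g _ h] assms by (simp add: hom1_iff)

lemma on_lunitor':
  assumes "f \<in> arrs M"
  shows "on_cell \<Phi> (lunitor M f) \<star>\<^bsub>B\<^esub> (on_comp \<Phi> (id1 M (trg M f)) f
        \<star>\<^bsub>B\<^esub> (on_unit \<Phi> (trg M f) \<boxtimes>\<^bsub>B\<^esub> id2 B (on_arr \<Phi> f)))
      = lunitor B (on_arr \<Phi> f)"
  using on_lunitor[of f] assms by (simp add: hom1_iff)

lemma on_runitor':
  assumes "f \<in> arrs M"
  shows "on_cell \<Phi> (runitor M f) \<star>\<^bsub>B\<^esub> (on_comp \<Phi> f (id1 M (src M f))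
        \<star>\<^bsub>B\<^esub> (id2 B (on_arr \<Phi> f) \<boxtimes>\<^bsub>B\<^esub> on_unit \<Phi> (src M f)))
      = runitor B (on_arr \<Phi> f)"
  using on_runitor[of f] assms by (simp add: hom1_iff)

lemma on_cell_inverse2: "inverse2 M \<alpha> \<beta> \<Longrightarrow> inverse2 B (on_cell \<Phi> \<alpha>) (on_cell \<Phi> \<beta>)"
  using on_cell_vcomp_simp[of \<alpha> \<beta>] on_cell_vcomp_simp[of \<beta> \<alpha>] by (auto simp: inverse2_def hom2_iff)

lemma on_cell_invertible2 [simp]: "invertible2 M \<alpha> \<Longrightarrow> invertible2 B (on_cell \<Phi> \<alpha>)"
  using on_cell_inverse2 unfolding invertible2_def by blast

end

lemma homomorphism_id_hom:
  assumes "bicategory M"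
  shows "homomorphism M M (id_hom M)"
proof -
  interpret bicategory M by fact
  show ?thesis
    by unfold_locales (auto simp: id_hom_def hom1_iff hom2_iff)
qed

text \<open>In each of the three coherence laws, naturality of \<open>on_comp \<Psi>\<close> slides
  a comparison cell of \<Psi> past the image of a comparison or unit cell of \<Phi>. This exposes
  the image under \<Psi> of the law for \<Phi>, after which the law for \<Psi> applies.\<close>

lemma homomorphism_comp_hom:
  assumes "homomorphism M B \<Phi>" "homomorphism B C \<Psi>"
  shows "homomorphism M C (comp_hom C \<Psi> \<Phi>)"
proof -
  interpret \<Phi>: homomorphism M B \<Phi> by fact
  interpret \<Psi>: homomorphism B C \<Psi> by fact
  let ?m = "on_comp \<Phi>" and ?n = "\<lambda>g f. on_comp \<Psi> (on_arr \<Phi> g) (on_arr \<Phi> f)"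
  show ?thesis
  proof (unfold_locales, goal_cases)
    case (8 \<alpha> f f' \<beta> g g')
    then have *: "\<alpha> \<in> cells M" "\<beta> \<in> cells M" "dom2 M \<alpha> = f" "dom2 M \<beta> = g" "cod2 M \<alpha> = f'" "cod2 M \<beta> = g'"
        "f \<in> arrs M" "g \<in> arrs M" "f' \<in> arrs M" "g' \<in> arrs M"
        "src M g = trg M f" "src M g' = trg M f" "trg M f' = trg M f"
      using \<Phi>.M.src_dom2 \<Phi>.M.trg_dom2 \<Phi>.M.dom2_in_arrs \<Phi>.M.cod2_in_arrs by (auto simp: hom2_iff)
    then have "(on_cell \<Psi> (?m g' f') \<star>\<^bsub>C\<^esub> ?n g' f') \<star>\<^bsub>C\<^esub>
        (on_cell \<Psi> (on_cell \<Phi> \<beta>) \<boxtimes>\<^bsub>C\<^esub> on_cell \<Psi> (on_cell \<Phi> \<alpha>))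
      = on_cell \<Psi> (?m g' f') \<star>\<^bsub>C\<^esub> (on_cell \<Psi> (on_cell \<Phi> \<beta> \<boxtimes>\<^bsub>B\<^esub> on_cell \<Phi> \<alpha>) \<star>\<^bsub>C\<^esub> ?n g f)"
      using \<Psi>.on_comp_natural'[of "on_cell \<Phi> \<alpha>" "on_cell \<Phi> \<beta>"] by simp
    also have "\<dots> = on_cell \<Psi> (on_cell \<Phi> (\<beta> \<boxtimes>\<^bsub>M\<^esub> \<alpha>)) \<star>\<^bsub>C\<^esub> (on_cell \<Psi> (?m g f) \<star>\<^bsub>C\<^esub> ?n g f)"
      using * \<Phi>.on_comp_natural'[of \<alpha> \<beta>, THEN arg_cong[where f="on_cell \<Psi>"]]
      by (intro \<Psi>.B.vcomp_eq_reassoc) simp_all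
    finally show ?case using * by (simp add: comp_hom_def)
  next
    case (11 f U V g W h X)
    then have *: "f \<in> arrs M" "g \<in> arrs M" "h \<in> arrs M" "src M g = trg M f" "src M h = trg M g"
      by (auto simp: hom1_iff)
    let ?f = "on_arr \<Phi> f" and ?g = "on_arr \<Phi> g" and ?h = "on_arr \<Phi> h"
    let ?i = "\<lambda>f. id2 C (on_arr \<Psi> (on_arr \<Phi> f))"
    let ?A = "associator C (on_arr \<Psi> ?h) (on_arr \<Psi> ?g) (on_arr \<Psi> ?f)"
    have "?n (h \<otimes>\<^bsub>M\<^esub> g) f \<star>\<^bsub>C\<^esub> ((on_cell \<Psi> (?m h g) \<boxtimes>\<^bsub>C\<^esub> ?i f) \<star>\<^bsub>C\<^esub> (?n h g \<boxtimes>\<^bsub>C\<^esub> ?i f))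
      = on_cell \<Psi> (?m h g \<boxtimes>\<^bsub>B\<^esub> id2 B ?f) \<star>\<^bsub>C\<^esub> (on_comp \<Psi> (?h \<otimes>\<^bsub>B\<^esub> ?g) ?f \<star>\<^bsub>C\<^esub> (?n h g \<boxtimes>\<^bsub>C\<^esub> ?i f))"
      using * \<Psi>.on_comp_natural'[of "id2 B ?f" "?m h g"]
      by (intro \<Psi>.B.vcomp_eq_reassoc) simp_all
    then have "on_cell \<Psi> (on_cell \<Phi> (associator M h g f)) \<star>\<^bsub>C\<^esub>
        (on_cell \<Psi> (?m (h \<otimes>\<^bsub>M\<^esub> g) f) \<star>\<^bsub>C\<^esub> (?n (h \<otimes>\<^bsub>M\<^esub> g) f \<star>\<^bsub>C\<^esub>
          ((on_cell \<Psi> (?m h g) \<boxtimes>\<^bsub>C\<^esub> ?i f) \<star>\<^bsub>C\<^esub> (?n h g \<boxtimes>\<^bsub>C\<^esub> ?i f))))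
      = on_cell \<Psi> (on_cell \<Phi> (associator M h g f) \<star>\<^bsub>B\<^esub> (?m (h \<otimes>\<^bsub>M\<^esub> g) f \<star>\<^bsub>B\<^esub> (?m h g \<boxtimes>\<^bsub>B\<^esub> id2 B ?f))) \<star>\<^bsub>C\<^esub>
          (on_comp \<Psi> (?h \<otimes>\<^bsub>B\<^esub> ?g) ?f \<star>\<^bsub>C\<^esub> (?n h g \<boxtimes>\<^bsub>C\<^esub> ?i f))"
      using * by simp
    also have "\<dots> = on_cell \<Psi> (?m h (g \<otimes>\<^bsub>M\<^esub> f)) \<star>\<^bsub>C\<^esub> (on_cell \<Psi> (id2 B ?h \<boxtimes>\<^bsub>B\<^esub> ?m g f) \<star>\<^bsub>C\<^esub>
        (on_cell \<Psi> (associator B ?h ?g ?f) \<star>\<^bsub>C\<^esub> (on_comp \<Psi> (?h \<otimes>\<^bsub>B\<^esub> ?g) ?f \<star>\<^bsub>C\<^esub> (?n h g \<boxtimes>\<^bsub>C\<^esub> ?i f))))"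
      using * by (simp add: \<Phi>.on_associator')
    also have "\<dots> = on_cell \<Psi> (?m h (g \<otimes>\<^bsub>M\<^esub> f)) \<star>\<^bsub>C\<^esub> (on_cell \<Psi> (id2 B ?h \<boxtimes>\<^bsub>B\<^esub> ?m g f) \<star>\<^bsub>C\<^esub>
        (on_comp \<Psi> ?h (?g \<otimes>\<^bsub>B\<^esub> ?f) \<star>\<^bsub>C\<^esub> ((?i h \<boxtimes>\<^bsub>C\<^esub> ?n g f) \<star>\<^bsub>C\<^esub> ?A)))"
      using * by (simp add: \<Psi>.on_associator')
    \<comment> \<open>The reverse slide, on the other side of the associativity law: it brings
      together the two factors of the comparison cell of the composite at \<open>h\<close> and
      \<open>g \<otimes> f\<close>.\<close>
    also have "on_cell \<Psi> (id2 B ?h \<boxtimes>\<^bsub>B\<^esub> ?m g f) \<star>\<^bsub>C\<^esub>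
        (on_comp \<Psi> ?h (?g \<otimes>\<^bsub>B\<^esub> ?f) \<star>\<^bsub>C\<^esub> ((?i h \<boxtimes>\<^bsub>C\<^esub> ?n g f) \<star>\<^bsub>C\<^esub> ?A))
      = ?n h (g \<otimes>\<^bsub>M\<^esub> f) \<star>\<^bsub>C\<^esub> ((?i h \<boxtimes>\<^bsub>C\<^esub> on_cell \<Psi> (?m g f)) \<star>\<^bsub>C\<^esub> ((?i h \<boxtimes>\<^bsub>C\<^esub> ?n g f) \<star>\<^bsub>C\<^esub> ?A))"
      using * \<Psi>.on_comp_natural'[of "?m g f" "id2 B ?h"]
      by (intro \<Psi>.B.vcomp_eq_reassoc) simp_all
    finally show ?case
      using * by (simp add: comp_hom_def \<Psi>.B.whisker_left_vcomp \<Psi>.B.whisker_right_vcomp)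
  next
    case (12 f U V)
    then have *: "f \<in> arrs M" "V = trg M f" by (auto simp: hom1_iff)
    let ?f = "on_arr \<Phi> f" and ?u = "on_unit \<Phi> V"
    let ?i = "id2 C (on_arr \<Psi> ?f)" and ?I = "id1 B (on_obj \<Phi> V)"
    let ?v = "on_unit \<Psi> (on_obj \<Phi> V) \<boxtimes>\<^bsub>C\<^esub> ?i"
    have "?n (id1 M V) f \<star>\<^bsub>C\<^esub> ((on_cell \<Psi> ?u \<boxtimes>\<^bsub>C\<^esub> ?i) \<star>\<^bsub>C\<^esub> ?v)
      = on_cell \<Psi> (?u \<boxtimes>\<^bsub>B\<^esub> id2 B ?f) \<star>\<^bsub>C\<^esub> (on_comp \<Psi> ?I ?f \<star>\<^bsub>C\<^esub> ?v)"
      using * \<Psi>.on_comp_natural'[of "id2 B ?f" ?u]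
      by (intro \<Psi>.B.vcomp_eq_reassoc) simp_all
    then have "on_cell \<Psi> (on_cell \<Phi> (lunitor M f)) \<star>\<^bsub>C\<^esub> (on_cell \<Psi> (?m (id1 M V) f) \<star>\<^bsub>C\<^esub>
        (?n (id1 M V) f \<star>\<^bsub>C\<^esub> ((on_cell \<Psi> ?u \<boxtimes>\<^bsub>C\<^esub> ?i) \<star>\<^bsub>C\<^esub> ?v)))
      = on_cell \<Psi> (on_cell \<Phi> (lunitor M f) \<star>\<^bsub>B\<^esub> (?m (id1 M V) f \<star>\<^bsub>B\<^esub> (?u \<boxtimes>\<^bsub>B\<^esub> id2 B ?f))) \<star>\<^bsub>C\<^esub>
        (on_comp \<Psi> ?I ?f \<star>\<^bsub>C\<^esub> ?v)"
      using * by simp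
    also have "\<dots> = lunitor C (on_arr \<Psi> ?f)"
      using * \<Psi>.on_lunitor'[of ?f] by (simp add: \<Phi>.on_lunitor')
    finally show ?case
      using * by (simp add: comp_hom_def \<Psi>.B.whisker_right_vcomp)
  next
    case (13 f U V)
    then have *: "f \<in> arrs M" "U = src M f" by (auto simp: hom1_iff)
    let ?f = "on_arr \<Phi> f" and ?u = "on_unit \<Phi> U"
    let ?i = "id2 C (on_arr \<Psi> ?f)" and ?I = "id1 B (on_obj \<Phi> U)"
    let ?v = "?i \<boxtimes>\<^bsub>C\<^esub> on_unit \<Psi> (on_obj \<Phi> U)"
    have "?n f (id1 M U) \<star>\<^bsub>C\<^esub> ((?i \<boxtimes>\<^bsub>C\<^esub> on_cell \<Psi> ?u) \<star>\<^bsub>C\<^esub> ?v)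
      = on_cell \<Psi> (id2 B ?f \<boxtimes>\<^bsub>B\<^esub> ?u) \<star>\<^bsub>C\<^esub> (on_comp \<Psi> ?f ?I \<star>\<^bsub>C\<^esub> ?v)"
      using * \<Psi>.on_comp_natural'[of ?u "id2 B ?f"]
      by (intro \<Psi>.B.vcomp_eq_reassoc) simp_all
    then have "on_cell \<Psi> (on_cell \<Phi> (runitor M f)) \<star>\<^bsub>C\<^esub> (on_cell \<Psi> (?m f (id1 M U)) \<star>\<^bsub>C\<^esub>
        (?n f (id1 M U) \<star>\<^bsub>C\<^esub> ((?i \<boxtimes>\<^bsub>C\<^esub> on_cell \<Psi> ?u) \<star>\<^bsub>C\<^esub> ?v)))
      = on_cell \<Psi> (on_cell \<Phi> (runitor M f) \<star>\<^bsub>B\<^esub> (?m f (id1 M U) \<star>\<^bsub>B\<^esub> (id2 B ?f \<boxtimes>\<^bsub>B\<^esub> ?u))) \<star>\<^bsub>C\<^esub>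
        (on_comp \<Psi> ?f ?I \<star>\<^bsub>C\<^esub> ?v)"
      using * by simp
    also have "\<dots> = runitor C (on_arr \<Psi> ?f)"
      using * \<Psi>.on_runitor'[of ?f] by (simp add: \<Phi>.on_runitor')
    finally show ?case
      using * by (simp add: comp_hom_def \<Psi>.B.whisker_left_vcomp)
  qed (auto simp: comp_hom_def hom1_iff hom2_iff)
qed

lemma eq_hom_sym: "eq_hom M \<Phi> \<Psi> \<Longrightarrow> eq_hom M \<Psi> \<Phi>"
  by (simp add: eq_hom_def)

lemma eq_hom_trans: "eq_hom M \<Phi> \<Psi> \<Longrightarrow> eq_hom M \<Psi> \<Theta> \<Longrightarrow> eq_hom M \<Phi> \<Theta>"
  by (simp add: eq_hom_def)

lemma eq_hom_comp_hom:
  "eq_hom M \<Phi> \<Psi> \<Longrightarrow> eq_hom M (comp_hom C \<Theta> \<Phi>) (comp_hom C \<Theta> \<Psi>)"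
  by (simp add: eq_hom_def comp_hom_def)

text \<open>The comparison and unit cells of the two bracketings agree because \<Theta> preserves
  vertical composites and vertical composition in \<open>D\<close> is associative, both only on the
  carriers.\<close>

lemma eq_hom_comp_hom_assoc:
  assumes "homomorphism M B \<Phi>" "homomorphism B C \<Psi>" "homomorphism C D \<Theta>"
  shows "eq_hom M (comp_hom D (comp_hom D \<Theta> \<Psi>) \<Phi>) (comp_hom D \<Theta> (comp_hom C \<Psi> \<Phi>))"
proof -
  interpret \<Phi>: homomorphism M B \<Phi> by fact
  interpret \<Psi>: homomorphism B C \<Psi> by fact
  interpret \<Theta>: homomorphism C D \<Theta> by fact
  show ?thesis by (simp add: eq_hom_def comp_hom_def)
qed

lemma eq_hom_comp_hom_id_hom:
  assumes "homomorphism M B \<Phi>"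
  shows "eq_hom M (comp_hom B (id_hom B) \<Phi>) \<Phi>"
proof -
  interpret \<Phi>: homomorphism M B \<Phi> by fact
  show ?thesis by (simp add: eq_hom_def comp_hom_def id_hom_def)
qed

subsection \<open>Equal homomorphisms are pseudonaturally equivalent\<close>

context bicategory
begin

text \<open>The canonical isomorphism \<open>f \<otimes> I \<rightarrow> I \<otimes> f\<close>, that
  is, the 2-cell component at \<open>f\<close> of an identity pseudonatural transformation.\<close>

definition unit_swap :: "'m \<Rightarrow> 'c" where
  "unit_swap f = inv2 B (lunitor B f) \<star> runitor B f"

lemma unit_swap_simps [simp]:
  assumes "f \<in> arrs B"
  shows "unit_swap f \<in> cells B" "dom2 B (unit_swap f) = f \<otimes> id1 B (src B f)"
    "cod2 B (unit_swap f) = id1 B (trg B f) \<otimes> f" "invertible2 B (unit_swap f)"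
  using assms by (simp_all add: unit_swap_def)

lemma lunitor_unit_swap: "f \<in> arrs B \<Longrightarrow> lunitor B f \<star> unit_swap f = runitor B f"
  by (simp add: unit_swap_def)

lemma unit_swap_natural:
  assumes \<alpha>: "\<alpha> \<in> cells B"
  shows "(id2 B (id1 B (trg B (dom2 B \<alpha>))) \<boxtimes> \<alpha>) \<star> unit_swap (dom2 B \<alpha>)
    = unit_swap (cod2 B \<alpha>) \<star> (\<alpha> \<boxtimes> id2 B (id1 B (src B (dom2 B \<alpha>))))"
proof (rule vcomp_left_cancel[of "lunitor B (cod2 B \<alpha>)"])
  have "lunitor B (cod2 B \<alpha>) \<star> ((id2 B (id1 B (trg B (dom2 B \<alpha>))) \<boxtimes> \<alpha>) \<star> unit_swap (dom2 B \<alpha>))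
      = \<alpha> \<star> (lunitor B (dom2 B \<alpha>) \<star> unit_swap (dom2 B \<alpha>))"
    using \<alpha> by (intro vcomp_eq_reassoc lunitor_natural') simp_all
  also have "\<dots> = runitor B (cod2 B \<alpha>) \<star> (\<alpha> \<boxtimes> id2 B (id1 B (src B (dom2 B \<alpha>))))"
    using \<alpha> by (simp add: lunitor_unit_swap runitor_natural')
  also have "\<dots> = lunitor B (cod2 B \<alpha>) \<star> (unit_swap (cod2 B \<alpha>) \<star> (\<alpha> \<boxtimes> id2 B (id1 B (src B (dom2 B \<alpha>)))))"
    using \<alpha> by (simp add: unit_swap_def)
  finally show "lunitor B (cod2 B \<alpha>) \<star> ((id2 B (id1 B (trg B (dom2 B \<alpha>))) \<boxtimes> \<alpha>) \<star> unit_swap (dom2 B \<alpha>))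
      = lunitor B (cod2 B \<alpha>) \<star> (unit_swap (cod2 B \<alpha>) \<star> (\<alpha> \<boxtimes> id2 B (id1 B (src B (dom2 B \<alpha>)))))" .
qed (use \<alpha> in simp_all)

text \<open>After composition with the left unitor of \<open>g \<otimes> f\<close> the right-hand
  side collapses: Kelly's law moves the unitor onto \<open>g\<close>, the swap at \<open>g\<close>
  turns it into a right unitor, the triangle moves it onto \<open>f\<close>, the swap at
  \<open>f\<close> turns it again, and the other law of Kelly ends at the right unitor of
  \<open>g \<otimes> f\<close>.\<close>

lemma unit_swap_comp1:
  assumes f: "f \<in> arrs B" and g: "g \<in> arrs B" and gf: "src B g = trg B f"
  defines "I \<equiv> id1 B (trg B f)"
  shows "unit_swap (g \<otimes> f) = associator B (id1 B (trg B g)) g f \<star> ((unit_swap g \<boxtimes> id2 B f) \<star>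
    (inv2 B (associator B g I f) \<star> ((id2 B g \<boxtimes> unit_swap f) \<star> associator B g f (id1 B (src B f)))))"
    (is "_ = ?a \<star> (_ \<star> ?rest)")
proof (rule vcomp_left_cancel[of "lunitor B (g \<otimes> f)"])
  have I: "I \<in> arrs B" "src B I = trg B f" "trg B I = trg B f" using f by (auto simp: I_def)
  note [simp] = f g gf I I_def[symmetric]
  have "lunitor B (g \<otimes> f) \<star> (?a \<star> ((unit_swap g \<boxtimes> id2 B f) \<star> ?rest))
      = (lunitor B g \<boxtimes> id2 B f) \<star> ((unit_swap g \<boxtimes> id2 B f) \<star> ?rest)"
    by (subst vcomp_assoc_simp[symmetric]) (simp_all add: lunitor_comp1)
  also have "\<dots> = (runitor B g \<boxtimes> id2 B f) \<star> ?rest"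
    by (subst vcomp_assoc_simp[symmetric]) (simp_all add: interchange' lunitor_unit_swap)
  also have "runitor B g \<boxtimes> id2 B f = (id2 B g \<boxtimes> lunitor B f) \<star> associator B g I f"
    using triangle'[of f g] by simp
  also have "((id2 B g \<boxtimes> lunitor B f) \<star> associator B g I f) \<star> ?rest
      = (id2 B g \<boxtimes> lunitor B f) \<star> ((id2 B g \<boxtimes> unit_swap f) \<star> associator B g f (id1 B (src B f)))"
    by simp
  also have "\<dots> = (id2 B g \<boxtimes> runitor B f) \<star> associator B g f (id1 B (src B f))"
    by (subst vcomp_assoc_simp[symmetric]) (simp_all add: interchange' lunitor_unit_swap)
  also have "\<dots> = runitor B (g \<otimes> f)"
    by (simp add: runitor_comp1)
  finally show "lunitor B (g \<otimes> f) \<star> unit_swap (g \<otimes> f)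
      = lunitor B (g \<otimes> f) \<star> (?a \<star> ((unit_swap g \<boxtimes> id2 B f) \<star> ?rest))"
    by (simp add: lunitor_unit_swap)
qed (use f g gf in \<open>simp_all add: I_def\<close>)

text \<open>The unit axiom of a pseudonatural transformation inverts the right unitor, whereas the
  swap inverts the left one; they agree here because the two unitors of a unit 1-cell
  coincide.\<close>

lemma unit_swap_id1:
  "U \<in> objs B \<Longrightarrow> unit_swap (id1 B U) = inv2 B (runitor B (id1 B U)) \<star> lunitor B (id1 B U)"
  by (simp add: unit_swap_def lunitor_id1_eq_runitor_id1)

lemma equivalence1_id1:
  assumes U: "U \<in> objs B"
  shows "equivalence1 B (id1 B U)"
proof -
  let ?I = "id1 B U"
  have "inv2 B (lunitor B ?I) \<in> hom2 B (id1 B (src B ?I)) (?I \<otimes> ?I)" "invertible2 B (inv2 B (lunitor B ?I))"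
    "lunitor B ?I \<in> hom2 B (?I \<otimes> ?I) (id1 B (trg B ?I))" "invertible2 B (lunitor B ?I)"
    "?I \<in> hom1 B (trg B ?I) (src B ?I)" "?I \<in> arrs B"
    using U by (simp_all add: hom1_iff hom2_iff)
  then show ?thesis
    unfolding equivalence1_def by blast
qed

end

text \<open>The three axioms are naturality of the swap at the image of a 2-cell, at a comparison
  cell and at a unit comparison cell; the last two are combined with the formulas for the swap at a
  composite and at a unit 1-cell.\<close>

lemma eq_hom_pseudonaturally_equivalent:
  assumes "homomorphism M B \<Phi>" "homomorphism M B \<Psi>" "eq_hom M \<Phi> \<Psi>"
  shows "pseudonaturally_equivalent M B \<Phi> \<Psi>"
proof -
  interpret \<Phi>: homomorphism M B \<Phi> by fact
  interpret \<Psi>: homomorphism M B \<Psi> by fact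
  have eq: "\<And>A. A \<in> objs M \<Longrightarrow> on_obj \<Psi> A = on_obj \<Phi> A"
    "\<And>f. f \<in> arrs M \<Longrightarrow> on_arr \<Psi> f = on_arr \<Phi> f"
    "\<And>\<alpha>. \<alpha> \<in> cells M \<Longrightarrow> on_cell \<Psi> \<alpha> = on_cell \<Phi> \<alpha>"
    "\<And>f g. f \<in> arrs M \<Longrightarrow> g \<in> arrs M \<Longrightarrow> src M g = trg M f \<Longrightarrow> on_comp \<Psi> g f = on_comp \<Phi> g f"
    "\<And>A. A \<in> objs M \<Longrightarrow> on_unit \<Psi> A = on_unit \<Phi> A"
    using assms(3) by (auto simp: eq_hom_def)
  define s where "s A = id1 B (on_obj \<Phi> A)" for A
  define t where "t f = \<Phi>.B.unit_swap (on_arr \<Phi> f)" for f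
  have "pseudonatural_transformation M B \<Phi> \<Psi> s t"
  proof (unfold_locales, goal_cases)
    case (4 f U V \<alpha> g)
    then show ?case
      using \<Phi>.B.unit_swap_natural[of "on_cell \<Phi> \<alpha>"] by (auto simp: s_def t_def hom1_iff hom2_iff eq)
  next
    case (5 f U V g W)
    then have *: "f \<in> arrs M" "g \<in> arrs M" "src M g = trg M f" "U = src M f" "V = trg M f" "W = trg M g"
      by (auto simp: hom1_iff)
    then show ?case
      using \<Phi>.B.unit_swap_natural[of "on_comp \<Phi> g f", symmetric]
        \<Phi>.B.unit_swap_comp1[of "on_arr \<Phi> f" "on_arr \<Phi> g"]
      by (simp add: s_def t_def eq)
  next
    case (6 A)
    then show ?case
      using \<Phi>.B.unit_swap_natural[of "on_unit \<Phi> A", symmetric] by (simp add: s_def t_def eq \<Phi>.B.unit_swap_id1)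
  qed (auto simp: s_def t_def hom1_iff hom2_iff eq)
  moreover have "\<forall>A\<in>objs M. equivalence1 B (s A)"
    by (simp add: s_def \<Phi>.B.equivalence1_id1)
  ultimately show ?thesis
    unfolding pseudonaturally_equivalent_def by blast
qed

section \<open>The localization as a vertical category\<close>

text \<open>Whiskering with a 1-cell makes sense only on the hom-categories whose endpoints match,
  hence the restriction to \<open>U\<close> and \<open>V\<close>. The source is \<open>M\<close>
  when a functor acts on zigzags step by step, and the localization when naturality is
  extended.\<close>

definition hom_functor ::
  "('o, 'm, 'c) bicat \<Rightarrow> 'o \<Rightarrow> 'o \<Rightarrow> ('p, 'n, 'd) bicat \<Rightarrow> ('m \<Rightarrow> 'n) \<Rightarrow> ('c \<Rightarrow> 'd) \<Rightarrow> bool" where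
  "hom_functor B U V D F\<^sub>0 F \<longleftrightarrow>
     (\<forall>f \<in> hom1 B U V. F\<^sub>0 f \<in> arrs D \<and> F (id2 B f) = id2 D (F\<^sub>0 f) \<and>
       (\<forall>\<alpha> g. \<alpha> \<in> hom2 B f g \<longrightarrow> F \<alpha> \<in> hom2 D (F\<^sub>0 f) (F\<^sub>0 g) \<and>
         (\<forall>\<beta> h. \<beta> \<in> hom2 B g h \<longrightarrow> F (\<beta> \<star>\<^bsub>B\<^esub> \<alpha>) = F \<beta> \<star>\<^bsub>D\<^esub> F \<alpha>)))"

lemma hom_functorD:
  assumes "hom_functor B U V D F\<^sub>0 F" "f \<in> hom1 B U V"
  shows "F\<^sub>0 f \<in> arrs D" "F (id2 B f) = id2 D (F\<^sub>0 f)"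
    "\<alpha> \<in> hom2 B f g \<Longrightarrow> F \<alpha> \<in> hom2 D (F\<^sub>0 f) (F\<^sub>0 g)"
    "\<alpha> \<in> hom2 B f g \<Longrightarrow> \<beta> \<in> hom2 B g h \<Longrightarrow> F (\<beta> \<star>\<^bsub>B\<^esub> \<alpha>) = F \<beta> \<star>\<^bsub>D\<^esub> F \<alpha>"
  using assms unfolding hom_functor_def by blast+

section \<open>Paths and the congruence on zigzags\<close>

context base_of_enrichment
begin

lemma weq_cells [simp]: "w \<in> \<W> \<Longrightarrow> w \<in> cells M"
  using weq_subset by blast

lemma path_arrs:
  assumes "path M \<W> f xs g"
  shows "f \<in> arrs M" "g \<in> arrs M" "src M g = src M f" "trg M g = trg M f"
proof -
  have "f \<in> arrs M \<and> g \<in> arrs M \<and> src M g = src M f \<and> trg M g = trg M f"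
    using assms
  proof (induction xs arbitrary: f)
    case (Cons x xs)
    then show ?case by (cases x) fastforce+
  qed auto
  then show "f \<in> arrs M" "g \<in> arrs M" "src M g = src M f" "trg M g = trg M f" by auto
qed

lemma path_append: "path M \<W> f (xs @ ys) h \<longleftrightarrow> (\<exists>g. path M \<W> f xs g \<and> path M \<W> g ys h)"
proof (induction xs arbitrary: f)
  case Nil
  then show ?case by (auto dest: path_arrs)
next
  case (Cons x xs)
  then show ?case by (cases x) auto
qed

lemma path_appendI [intro]: "path M \<W> f xs g \<Longrightarrow> path M \<W> g ys h \<Longrightarrow> path M \<W> f (xs @ ys) h"
  using path_append by blast

text \<open>The generating rules ask only their left-hand side to be a path. That the right-hand
  side is then a path with the same endpoints makes the domain and codomain of a class well
  defined.\<close>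

lemma zigzag_eq_zigzags:
  assumes "zigzag_eq M \<W> z z'"
  shows "z \<in> zigzags M \<W> \<and> z' \<in> zigzags M \<W> \<and> fst z' = fst z \<and> snd (snd z') = snd (snd z)"
  using assms
proof induction
  case (vcomp f xs \<alpha> \<beta> ys g)
  then show ?case by (auto simp: zigzags_def path_append)
next
  case (id2 h f xs ys g)
  then show ?case by (auto simp: zigzags_def path_append)
next
  case (fwd_bwd f xs w ys g)
  then show ?case by (auto simp: zigzags_def path_append)
next
  case (bwd_fwd f xs w ys g)
  then show ?case by (auto simp: zigzags_def path_append)
qed auto

lemma zigzag_eq_path:
  assumes "zigzag_eq M \<W> (f, xs, g) (f', xs', g')"
  shows "path M \<W> f xs g" "path M \<W> f xs' g" "f' = f" "g' = g"
  using zigzag_eq_zigzags[OF assms] by (auto simp: zigzags_def)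

text \<open>Every generating rule already carries a context on both sides, which absorbs
  \<open>us\<close> and \<open>vs\<close>; what remains is to propagate this through symmetry and
  transitivity, using that related zigzags share their endpoints.\<close>

lemma zigzag_eq_append:
  assumes "zigzag_eq M \<W> z z'" "path M \<W> e us (fst z)" "path M \<W> (snd (snd z)) vs h"
  shows "zigzag_eq M \<W> (e, us @ fst (snd z) @ vs, h) (e, us @ fst (snd z') @ vs, h)"
  using assms
proof induction
  case (refl z)
  then show ?case by (intro zigzag_eq.refl) (auto simp: zigzags_def path_append, blast)
next
  case (sym z z')
  then show ?case using zigzag_eq_zigzags[OF sym.hyps] by (simp add: zigzag_eq.sym[OF sym.IH])
next
  case (trans z z' z'')
  then show ?case
    using zigzag_eq_zigzags[OF trans.hyps(1)] by (intro zigzag_eq.trans[OF trans.IH]) simp_all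
next
  case (vcomp f xs \<alpha> \<beta> ys g)
  then show ?case
    using zigzag_eq.vcomp[of M \<W> e "us @ xs" \<alpha> \<beta> "ys @ vs" h] by (auto simp: path_append)
next
  case (id2 k f xs ys g)
  then show ?case
    using zigzag_eq.id2[of k M \<W> e "us @ xs" "ys @ vs" h] by (auto simp: path_append)
next
  case (fwd_bwd f xs w ys g)
  then show ?case
    using zigzag_eq.fwd_bwd[of M \<W> e "us @ xs" w "ys @ vs" h] by (auto simp: path_append)
next
  case (bwd_fwd f xs w ys g)
  then show ?case
    using zigzag_eq.bwd_fwd[of M \<W> e "us @ xs" w "ys @ vs" h] by (auto simp: path_append)
qed

lemma path_map:
  assumes F: "hom_functor M U V M F\<^sub>0 F"
    and W: "\<And>w. w \<in> \<W> \<Longrightarrow> dom2 M w \<in> hom1 M U V \<Longrightarrow> F w \<in> \<W>"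
  shows "path M \<W> f xs g \<Longrightarrow> f \<in> hom1 M U V \<Longrightarrow> path M \<W> (F\<^sub>0 f) (map (map_step F) xs) (F\<^sub>0 g)"
proof (induction xs arbitrary: f)
  case Nil
  then show ?case using hom_functorD(1)[OF F] by auto
next
  case (Cons x xs)
  show ?case
  proof (cases x)
    case (Fwd \<alpha>)
    then have "F \<alpha> \<in> hom2 M (F\<^sub>0 f) (F\<^sub>0 (cod2 M \<alpha>))"
      using Cons.prems by (intro hom_functorD(3)[OF F]) (auto simp: hom2_iff)
    then show ?thesis using Fwd Cons by (auto simp: hom2_iff hom1_iff)
  next
    case (Bwd w)
    have "dom2 M w \<in> hom1 M U V" using Bwd Cons.prems by (auto simp: hom1_iff)
    moreover from this have "F w \<in> hom2 M (F\<^sub>0 (dom2 M w)) (F\<^sub>0 f)"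
      using Bwd Cons.prems by (intro hom_functorD(3)[OF F]) (auto simp: hom2_iff)
    ultimately show ?thesis using Bwd Cons W by (auto simp: hom2_iff)
  qed
qed

text \<open>A functor on a hom-category that preserves \<open>\<W>\<close> sends each generating
  rule to an instance of the same rule. Preservation of \<open>\<W>\<close> is what allows backward
  steps to be mapped. The two whiskerings are the intended instances.\<close>

lemma zigzag_eq_map:
  assumes F: "hom_functor M U V M F\<^sub>0 F"
    and W: "\<And>w. w \<in> \<W> \<Longrightarrow> dom2 M w \<in> hom1 M U V \<Longrightarrow> F w \<in> \<W>"
  defines "m \<equiv> \<lambda>(f, xs, g). (F\<^sub>0 f, map (map_step F) xs, F\<^sub>0 g)"
  assumes "zigzag_eq M \<W> z z'" "fst z \<in> hom1 M U V"
  shows "zigzag_eq M \<W> (m z) (m z')"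
  using assms(4,5)
proof induction
  case (refl z)
  then show ?case using path_map[OF F W] by (intro zigzag_eq.refl) (auto simp: zigzags_def m_def)
next
  case (sym z z')
  then show ?case using zigzag_eq_zigzags[OF sym.hyps] by (simp add: zigzag_eq.sym[OF sym.IH])
next
  case (trans z z' z'')
  then show ?case
    using zigzag_eq_zigzags[OF trans.hyps(1)] by (intro zigzag_eq.trans[OF trans.IH]) simp_all
next
  case (vcomp f xs \<alpha> \<beta> ys g)
  have "\<alpha> \<in> hom2 M (dom2 M \<alpha>) (cod2 M \<alpha>)" "\<beta> \<in> hom2 M (cod2 M \<alpha>) (cod2 M \<beta>)" "dom2 M \<alpha> \<in> hom1 M U V"
    using vcomp path_arrs[of f xs] by (auto simp: path_append hom1_iff hom2_iff)
  then have "F (\<beta> \<star> \<alpha>) = F \<beta> \<star> F \<alpha>"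
    using hom_functorD(4)[OF F] by blast
  then show ?case
    using zigzag_eq.vcomp[of M \<W> "F\<^sub>0 f" "map (map_step F) xs" "F \<alpha>" "F \<beta>" "map (map_step F) ys" "F\<^sub>0 g"]
      path_map[OF F W vcomp.hyps] vcomp.prems by (auto simp: m_def)
next
  case (id2 h f xs ys g)
  then have "h \<in> hom1 M U V"
    using path_arrs[of f xs] by (auto simp: path_append hom1_iff)
  then have "F (id2 M h) = id2 M (F\<^sub>0 h)" "F\<^sub>0 h \<in> arrs M"
    using hom_functorD(1,2)[OF F] by blast+
  then show ?case
    using zigzag_eq.id2[of "F\<^sub>0 h" M \<W> "F\<^sub>0 f" "map (map_step F) xs" "map (map_step F) ys" "F\<^sub>0 g"]
      path_map[OF F W id2.hyps(2)] id2.prems by (auto simp: m_def)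
next
  case (fwd_bwd f xs w ys g)
  then show ?case
    using zigzag_eq.fwd_bwd[of M \<W> "F\<^sub>0 f" "map (map_step F) xs" "F w" "map (map_step F) ys" "F\<^sub>0 g"]
      path_map[OF F W fwd_bwd.hyps] by (auto simp: m_def)
next
  case (bwd_fwd f xs w ys g)
  then show ?case
    using zigzag_eq.bwd_fwd[of M \<W> "F\<^sub>0 f" "map (map_step F) xs" "F w" "map (map_step F) ys" "F\<^sub>0 g"]
      path_map[OF F W bwd_fwd.hyps] by (auto simp: m_def)
qed

section \<open>Classes of zigzags as the cells of the localization\<close>

abbreviation zclass :: "'m \<Rightarrow> 'c step list \<Rightarrow> 'm \<Rightarrow> ('m, 'c) zigzag set" where
  "zclass f xs g \<equiv> zigzag_class M \<W> (f, xs, g)"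

abbreviation Loc :: "('o, 'm, ('m, 'c) zigzag set) bicat" where
  "Loc \<equiv> localization M \<W>"

lemma zclass_eqI: "zigzag_eq M \<W> z z' \<Longrightarrow> zigzag_class M \<W> z = zigzag_class M \<W> z'"
  unfolding zigzag_class_def by (blast intro: zigzag_eq.sym zigzag_eq.trans)

lemma zclass_refl: "path M \<W> f xs g \<Longrightarrow> (f, xs, g) \<in> zclass f xs g"
  unfolding zigzag_class_def by (auto intro: zigzag_eq.refl simp: zigzags_def)

lemma zclass_member:
  assumes "(f', xs', g') \<in> zclass f xs g"
  shows "f' = f" "g' = g" "path M \<W> f xs' g" "zigzag_eq M \<W> (f, xs, g) (f, xs', g)"
  using assms zigzag_eq_path[of f xs g f' xs' g'] by (auto simp: zigzag_class_def)

lemma Loc_simps [simp]: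
  "objs Loc = objs M" "arrs Loc = arrs M" "src Loc = src M" "trg Loc = trg M" "id1 Loc = id1 M"
  "comp1 Loc = comp1 M"
  "associator Loc h g f = fwd_class M \<W> (associator M h g f)"
  "lunitor Loc f = fwd_class M \<W> (lunitor M f)" "runitor Loc f = fwd_class M \<W> (runitor M f)"
  by (simp_all add: localization_def)

lemma id2_Loc: "id2 Loc f = zclass f [] f"
  by (simp add: localization_def)

lemma hom1_Loc [simp]: "hom1 Loc = hom1 M"
  by (simp add: hom1_def fun_eq_iff)

lemma cells_Loc: "X \<in> cells Loc \<longleftrightarrow> (\<exists>f xs g. X = zclass f xs g \<and> path M \<W> f xs g)"
  by (auto simp: localization_def zigzags_def)

lemma zclass_simps [simp]:
  assumes "path M \<W> f xs g"
  shows "zclass f xs g \<in> cells Loc" "dom2 Loc (zclass f xs g) = f" "cod2 Loc (zclass f xs g) = g"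
proof -
  have "(\<lambda>(f, xs, g). f) ` zclass f xs g = {f}" "(\<lambda>(f, xs, g). g) ` zclass f xs g = {g}"
    using zclass_refl[OF assms] by (auto dest: zclass_member intro: rev_image_eqI)
  then show "zclass f xs g \<in> cells Loc" "dom2 Loc (zclass f xs g) = f" "cod2 Loc (zclass f xs g) = g"
    using assms by (auto simp: cells_Loc) (simp_all add: localization_def)
qed

lemma hom2_Loc: "X \<in> hom2 Loc f g \<longleftrightarrow> (\<exists>xs. X = zclass f xs g \<and> path M \<W> f xs g)"
  by (auto simp: hom2_iff cells_Loc)

text \<open>Changing the representatives of the two factors, one after the other, does not change
  the class of the concatenation, so the union in the definition is taken over a single
  class.\<close>

lemma vcomp_zclass:
  assumes "path M \<W> f xs g" "path M \<W> g ys h"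
  shows "zclass g ys h \<star>\<^bsub>Loc\<^esub> zclass f xs g = zclass f (xs @ ys) h"
proof -
  have eq: "zclass f (xs' @ ys') h = zclass f (xs @ ys) h"
    if "zigzag_eq M \<W> (f, xs, g) (f, xs', g)" "zigzag_eq M \<W> (g, ys, h) (g, ys', h)" for xs' ys'
  proof -
    have "zigzag_eq M \<W> (f, xs @ ys, h) (f, xs' @ ys, h)"
      using zigzag_eq_append[OF that(1), of f "[]" ys h] assms by (auto dest: path_arrs)
    moreover have "zigzag_eq M \<W> (f, xs' @ ys, h) (f, xs' @ ys', h)"
      using zigzag_eq_append[OF that(2), of f xs' "[]" h] assms zigzag_eq_path[OF that(1)]
      by (auto dest: path_arrs)
    ultimately show ?thesis
      using zclass_eqI zigzag_eq.trans by metis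
  qed
  have "{zclass f' (xs' @ ys') h' | f' xs' g' ys' h'.
      (f', xs', g') \<in> zclass f xs g \<and> (g', ys', h') \<in> zclass g ys h} = {zclass f (xs @ ys) h}"
    (is "?S = _")
  proof
    show "?S \<subseteq> {zclass f (xs @ ys) h}"
    proof
      fix T assume "T \<in> ?S"
      then obtain f' xs' g' ys' h' where T: "T = zclass f' (xs' @ ys') h'"
        "(f', xs', g') \<in> zclass f xs g" "(g', ys', h') \<in> zclass g ys h" by blast
      show "T \<in> {zclass f (xs @ ys) h}"
        using T(1) zclass_member[OF T(2)] zclass_member[OF T(3)] eq by simp
    qed
    show "{zclass f (xs @ ys) h} \<subseteq> ?S"
      using zclass_refl assms by blast
  qed
  then show ?thesis
    unfolding localization_def by simp
qed

text \<open>Concatenation of lists is strictly associative and unital, so these laws hold already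
  for representatives.\<close>

sublocale L: vertical_category Loc
proof (unfold_locales, goal_cases)
  case (1 X)
  then show ?case by (auto simp: cells_Loc dest: path_arrs)
next
  case (2 X)
  then show ?case by (auto simp: cells_Loc dest: path_arrs)
next
  case (3 f)
  then show ?case by (auto simp: hom2_iff id2_Loc)
next
  case (4 X f g Y h)
  then show ?case by (auto simp: hom2_Loc vcomp_zclass)
next
  case (5 X f g)
  then obtain xs where "X = zclass f xs g" "path M \<W> f xs g" by (auto simp: hom2_Loc)
  then show ?case using vcomp_zclass[of f xs g "[]" g] path_arrs[of f xs g] by (simp add: id2_Loc)
next
  case (6 X f g)
  then obtain xs where "X = zclass f xs g" "path M \<W> f xs g" by (auto simp: hom2_Loc)
  then show ?case using vcomp_zclass[of f "[]" f xs g] path_arrs[of f xs g] by (simp add: id2_Loc)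
next
  case (7 X f g Y h Z k)
  then show ?case by (auto simp: hom2_Loc vcomp_zclass path_appendI)
qed

lemma Loc_cell_simps [simp]:
  assumes "X \<in> cells Loc"
  shows "dom2 Loc X \<in> arrs M" "cod2 Loc X \<in> arrs M"
    "src M (cod2 Loc X) = src M (dom2 Loc X)" "trg M (cod2 Loc X) = trg M (dom2 Loc X)"
  using assms by (auto simp: cells_Loc dest: path_arrs)

lemma fwd_class_eq: "fwd_class M \<W> \<alpha> = zclass (dom2 M \<alpha>) [Fwd \<alpha>] (cod2 M \<alpha>)"
  by (simp add: fwd_class_def)

lemma fwd_class_simps [simp]:
  assumes "\<alpha> \<in> cells M"
  shows "fwd_class M \<W> \<alpha> \<in> cells Loc" "dom2 Loc (fwd_class M \<W> \<alpha>) = dom2 M \<alpha>"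
    "cod2 Loc (fwd_class M \<W> \<alpha>) = cod2 M \<alpha>"
  using assms by (auto simp: fwd_class_eq)

lemma fwd_class_vcomp:
  "\<alpha> \<in> cells M \<Longrightarrow> \<beta> \<in> cells M \<Longrightarrow> dom2 M \<beta> = cod2 M \<alpha> \<Longrightarrow>
    fwd_class M \<W> \<beta> \<star>\<^bsub>Loc\<^esub> fwd_class M \<W> \<alpha> = fwd_class M \<W> (\<beta> \<star> \<alpha>)"
  using zclass_eqI[OF zigzag_eq.vcomp[of M \<W> "dom2 M \<alpha>" "[]" \<alpha> \<beta> "[]" "cod2 M \<beta>"]]
  by (simp add: fwd_class_eq vcomp_zclass)

lemma fwd_class_id2: "f \<in> arrs M \<Longrightarrow> fwd_class M \<W> (id2 M f) = id2 Loc f"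
  using zclass_eqI[OF zigzag_eq.id2[of f M \<W> f "[]" "[]" f]] by (simp add: fwd_class_eq id2_Loc)

lemma fwd_class_inverse2:
  "inverse2 M \<alpha> \<beta> \<Longrightarrow> inverse2 Loc (fwd_class M \<W> \<alpha>) (fwd_class M \<W> \<beta>)"
  by (auto simp: inverse2_def hom2_iff fwd_class_vcomp fwd_class_id2)

lemma fwd_class_invertible2 [simp]: "invertible2 M \<alpha> \<Longrightarrow> invertible2 Loc (fwd_class M \<W> \<alpha>)"
  using fwd_class_inverse2 unfolding invertible2_def by blast

lemma weq_inverse2:
  "w \<in> \<W> \<Longrightarrow> inverse2 Loc (fwd_class M \<W> w) (zclass (cod2 M w) [Bwd w] (dom2 M w))"
  using zclass_eqI[OF zigzag_eq.fwd_bwd[of M \<W> "dom2 M w" "[]" w "[]" "dom2 M w"]]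
    zclass_eqI[OF zigzag_eq.bwd_fwd[of M \<W> "cod2 M w" "[]" w "[]" "cod2 M w"]]
  by (simp add: inverse2_def hom2_iff fwd_class_eq id2_Loc vcomp_zclass)

lemma makes_invertible_localization_hom: "makes_invertible \<W> Loc (localization_hom M \<W>)"
  using weq_inverse2 L.inverse2_invertible2
  by (fastforce simp: makes_invertible_def localization_hom_def)

text \<open>The cells of a localized hom-category are composites of forward classes and of inverses
  of forward classes. Naturality squares paste along composites, and the square of a 2-cell of
  \<open>\<W>\<close> reverses because every functor keeps its image invertible. The target is only
  asked to be a vertical category, so it may be the localization itself at a stage where its
  horizontal laws are still open.\<close>

lemma natural_extend:
  assumes "vertical_category D" and F: "hom_functor Loc U V D F\<^sub>0 F" and G: "hom_functor Loc U V D G\<^sub>0 G"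
    and \<tau>: "\<And>f. f \<in> hom1 M U V \<Longrightarrow> \<tau> f \<in> hom2 D (F\<^sub>0 f) (G\<^sub>0 f)"
    and nat: "\<And>\<alpha>. \<alpha> \<in> cells M \<Longrightarrow> dom2 M \<alpha> \<in> hom1 M U V \<Longrightarrow>
      \<tau> (cod2 M \<alpha>) \<star>\<^bsub>D\<^esub> F (fwd_class M \<W> \<alpha>) = G (fwd_class M \<W> \<alpha>) \<star>\<^bsub>D\<^esub> \<tau> (dom2 M \<alpha>)"
    and X: "X \<in> cells Loc" "dom2 Loc X \<in> hom1 M U V"
  shows "\<tau> (cod2 Loc X) \<star>\<^bsub>D\<^esub> F X = G X \<star>\<^bsub>D\<^esub> \<tau> (dom2 Loc X)"
proof -
  interpret D: vertical_category D by fact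
  let ?nat = "\<lambda>X. \<tau> (cod2 Loc X) \<star>\<^bsub>D\<^esub> F X = G X \<star>\<^bsub>D\<^esub> \<tau> (dom2 Loc X)"
  \<comment> \<open>Pasting: the squares of \<open>X\<close> and \<open>Y\<close> share the
    component at the codomain of \<open>X\<close>.\<close>
  have comp: "?nat (Y \<star>\<^bsub>Loc\<^esub> X)"
    if "X \<in> cells Loc" "Y \<in> cells Loc" "dom2 Loc Y = cod2 Loc X" "dom2 Loc X \<in> hom1 M U V" "?nat X" "?nat Y"
    for X Y
  proof -
    let ?f = "dom2 Loc X" and ?g = "cod2 Loc X" and ?h = "cod2 Loc Y"
    have hom: "X \<in> hom2 Loc ?f ?g" "Y \<in> hom2 Loc ?g ?h" "?f \<in> hom1 M U V" "?g \<in> hom1 M U V" "?h \<in> hom1 M U V"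
      using that by (auto simp: hom1_iff hom2_iff)
    have FG: "F X \<in> hom2 D (F\<^sub>0 ?f) (F\<^sub>0 ?g)" "F Y \<in> hom2 D (F\<^sub>0 ?g) (F\<^sub>0 ?h)"
        "G X \<in> hom2 D (G\<^sub>0 ?f) (G\<^sub>0 ?g)" "G Y \<in> hom2 D (G\<^sub>0 ?g) (G\<^sub>0 ?h)"
        "F (Y \<star>\<^bsub>Loc\<^esub> X) = F Y \<star>\<^bsub>D\<^esub> F X" "G (Y \<star>\<^bsub>Loc\<^esub> X) = G Y \<star>\<^bsub>D\<^esub> G X"
      using hom_functorD(3,4)[OF F, unfolded hom1_Loc] hom_functorD(3,4)[OF G, unfolded hom1_Loc] hom by blast+
    note hom2s = FG(1-4) hom(3-5)[THEN \<tau>]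
    have "\<tau> ?h \<star>\<^bsub>D\<^esub> (F Y \<star>\<^bsub>D\<^esub> F X) = G Y \<star>\<^bsub>D\<^esub> (\<tau> ?g \<star>\<^bsub>D\<^esub> F X)"
      using that hom2s by (intro D.vcomp_eq_reassoc) (auto simp: hom2_iff)
    also have "\<tau> ?g \<star>\<^bsub>D\<^esub> F X = G X \<star>\<^bsub>D\<^esub> \<tau> ?f" using that by simp
    finally show ?thesis
      using that hom2s by (simp add: FG(5,6) hom2_iff)
  qed
  have "?nat (zclass f xs g)" if "path M \<W> f xs g" "f \<in> hom1 M U V" for f xs g
    using that
  proof (induction xs arbitrary: f)
    case Nil
    then show ?case
      using hom_functorD(2)[OF F, of f] hom_functorD(2)[OF G, of f] \<tau>[of f] by (auto simp: hom2_iff id2_Loc)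
  next
    case (Cons x xs)
    show ?case
    proof (cases x)
      case (Fwd \<alpha>)
      then have *: "\<alpha> \<in> cells M" "dom2 M \<alpha> = f" "path M \<W> (cod2 M \<alpha>) xs g" using Cons.prems by auto
      then have "cod2 M \<alpha> \<in> hom1 M U V" using Cons.prems by (auto simp: hom1_iff)
      then have "?nat (zclass (cod2 M \<alpha>) xs g \<star>\<^bsub>Loc\<^esub> fwd_class M \<W> \<alpha>)"
        using * Cons.prems Cons.IH nat[of \<alpha>] by (intro comp) auto
      then show ?thesis using * Fwd by (simp add: fwd_class_eq vcomp_zclass)
    next
      case (Bwd w)
      then have *: "w \<in> \<W>" "cod2 M w = f" "path M \<W> (dom2 M w) xs g" using Cons.prems by auto
      let ?X = "zclass f [Bwd w] (dom2 M w)"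
      have dw: "dom2 M w \<in> hom1 M U V" using Cons.prems * by (auto simp: hom1_iff)
      have inv: "inverse2 Loc (fwd_class M \<W> w) ?X" using weq_inverse2 * by auto
      \<comment> \<open>A functor preserves inverse pairs; this is proved for a generic
        \<open>H\<close> so that it serves for both \<open>F\<close> and \<open>G\<close>.\<close>
      have "inverse2 D (H (fwd_class M \<W> w)) (H ?X)" if H: "hom_functor Loc U V D H\<^sub>0 H" for H\<^sub>0 H
      proof -
        have h: "fwd_class M \<W> w \<in> hom2 Loc (dom2 M w) f" "?X \<in> hom2 Loc f (dom2 M w)"
          using * by (auto simp: hom2_iff)
        show ?thesis
          using hom_functorD(3)[OF H, unfolded hom1_Loc, OF dw h(1)] hom_functorD(3)[OF H, unfolded hom1_Loc, OF Cons.prems(2) h(2)]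
            hom_functorD(4)[OF H, unfolded hom1_Loc, OF dw h, symmetric] hom_functorD(4)[OF H, unfolded hom1_Loc, OF Cons.prems(2) h(2,1), symmetric]
            hom_functorD(2)[OF H, unfolded hom1_Loc, OF dw] hom_functorD(2)[OF H, unfolded hom1_Loc, OF Cons.prems(2)] inv *
          by (auto simp: inverse2_def hom2_iff)
      qed
      then have inv2: "inverse2 D (F (fwd_class M \<W> w)) (F ?X)" "inverse2 D (G (fwd_class M \<W> w)) (G ?X)"
        using F G by blast+
      have FG: "F (fwd_class M \<W> w) \<in> hom2 D (F\<^sub>0 (dom2 M w)) (F\<^sub>0 f)"
        "G (fwd_class M \<W> w) \<in> hom2 D (G\<^sub>0 (dom2 M w)) (G\<^sub>0 f)"
        using hom_functorD(3)[OF F, unfolded hom1_Loc, OF dw] hom_functorD(3)[OF G, unfolded hom1_Loc, OF dw] *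
        by (auto simp: hom2_iff)
      have "\<tau> f \<star>\<^bsub>D\<^esub> F (fwd_class M \<W> w) = G (fwd_class M \<W> w) \<star>\<^bsub>D\<^esub> \<tau> (dom2 M w)"
        using nat[of w] dw * by simp
      then have "\<tau> (dom2 M w) \<star>\<^bsub>D\<^esub> F ?X = G ?X \<star>\<^bsub>D\<^esub> \<tau> f"
        using FG \<tau>[OF dw] \<tau>[OF Cons.prems(2)]
        by (intro D.square_inverse[OF _ inv2]) (simp_all add: hom2_iff)
      then have "?nat ?X" using * by simp
      then have "?nat (zclass (dom2 M w) xs g \<star>\<^bsub>Loc\<^esub> ?X)"
        using * dw Cons.prems Cons.IH by (intro comp) auto
      then show ?thesis using * Bwd by (simp add: vcomp_zclass)
    qed
  qed
  then show ?thesis using X by (auto simp: cells_Loc)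
qed

end

section \<open>The localization as a bicategory\<close>

context base_of_enrichment
begin

section \<open>Whiskering and horizontal composition of classes\<close>

lemma hom_functor_whisker_left:
  "g \<in> arrs M \<Longrightarrow> src M g = V \<Longrightarrow> hom_functor M U V M (\<lambda>f. g \<otimes> f) (\<lambda>\<alpha>. id2 M g \<boxtimes> \<alpha>)"
  by (auto simp: hom_functor_def hom1_iff hom2_iff whisker_left_vcomp)

lemma hom_functor_whisker_right:
  "f \<in> arrs M \<Longrightarrow> trg M f = U \<Longrightarrow> hom_functor M U V M (\<lambda>g. g \<otimes> f) (\<lambda>\<beta>. \<beta> \<boxtimes> id2 M f)"
  by (auto simp: hom_functor_def hom1_iff hom2_iff whisker_right_vcomp)

text \<open>Identity 2-cells are invertible and hence lie in \<open>\<W>\<close>, so stability under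
  horizontal composition contains stability under whiskering. Thus a whiskered backward step is
  again a legitimate backward step.\<close>

lemma weq_whisker_left:
  "w \<in> \<W> \<Longrightarrow> g \<in> arrs M \<Longrightarrow> src M g = trg M (dom2 M w) \<Longrightarrow> id2 M g \<boxtimes> w \<in> \<W>"
  by (rule weq_hcomp[of w "dom2 M w" "cod2 M w" _ g g]) (auto simp: hom2_iff invertible_weq)

lemma weq_whisker_right:
  "w \<in> \<W> \<Longrightarrow> f \<in> arrs M \<Longrightarrow> trg M f = src M (dom2 M w) \<Longrightarrow> w \<boxtimes> id2 M f \<in> \<W>"
  by (rule weq_hcomp[of _ f f w "dom2 M w" "cod2 M w"]) (auto simp: hom2_iff invertible_weq)

abbreviation lwhisker :: "'m \<Rightarrow> 'c step list \<Rightarrow> 'c step list" where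
  "lwhisker g \<equiv> map (map_step (\<lambda>\<alpha>. id2 M g \<boxtimes> \<alpha>))"

abbreviation rwhisker :: "'c step list \<Rightarrow> 'm \<Rightarrow> 'c step list" where
  "rwhisker ys f \<equiv> map (map_step (\<lambda>\<beta>. \<beta> \<boxtimes> id2 M f)) ys"

lemma path_lwhisker:
  "path M \<W> f xs f' \<Longrightarrow> g \<in> arrs M \<Longrightarrow> src M g = trg M f \<Longrightarrow> path M \<W> (g \<otimes> f) (lwhisker g xs) (g \<otimes> f')"
  using path_map[OF hom_functor_whisker_left[of g "trg M f" "src M f"]]
  by (auto simp: hom1_iff weq_whisker_left dest: path_arrs)

lemma path_rwhisker:
  "path M \<W> g ys g' \<Longrightarrow> f \<in> arrs M \<Longrightarrow> src M g = trg M f \<Longrightarrow> path M \<W> (g \<otimes> f) (rwhisker ys f) (g' \<otimes> f)"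
  using path_map[OF hom_functor_whisker_right[of f "src M g" "trg M g"]]
  by (auto simp: hom1_iff weq_whisker_right dest: path_arrs)

text \<open>Each whiskering preserves \<open>\<W>\<close> and therefore acts on classes. The
  composite passes through \<open>g' \<otimes> f\<close>, where the two halves can be replaced
  independently, so the union in the definition again ranges over a single class.\<close>

lemma hcomp_zclass:
  assumes xs: "path M \<W> f xs f'" and ys: "path M \<W> g ys g'" and gf: "src M g = trg M f"
  shows "zclass g ys g' \<boxtimes>\<^bsub>Loc\<^esub> zclass f xs f' = zclass (g \<otimes> f) (rwhisker ys f @ lwhisker g' xs) (g' \<otimes> f')"
proof -
  have arrs: "f \<in> arrs M" "g' \<in> arrs M" "src M g' = trg M f" "g \<in> arrs M"
    using path_arrs[OF xs] path_arrs[OF ys] gf by auto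
  have eq: "zclass (g \<otimes> f) (rwhisker ys' f @ lwhisker g' xs') (g' \<otimes> f')
      = zclass (g \<otimes> f) (rwhisker ys f @ lwhisker g' xs) (g' \<otimes> f')"
    if xs': "zigzag_eq M \<W> (f, xs, f') (f, xs', f')" and ys': "zigzag_eq M \<W> (g, ys, g') (g, ys', g')"
    for xs' ys'
  proof -
    have l: "zigzag_eq M \<W> (g' \<otimes> f, lwhisker g' xs, g' \<otimes> f') (g' \<otimes> f, lwhisker g' xs', g' \<otimes> f')"
      using zigzag_eq_map[OF hom_functor_whisker_left[of g' "trg M f" "src M f"] _ xs'] arrs
      by (auto simp: hom1_iff weq_whisker_left)
    have r: "zigzag_eq M \<W> (g \<otimes> f, rwhisker ys f, g' \<otimes> f) (g \<otimes> f, rwhisker ys' f, g' \<otimes> f)"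
      using zigzag_eq_map[OF hom_functor_whisker_right[of f "src M g" "trg M g"] _ ys'] arrs gf
      by (auto simp: hom1_iff weq_whisker_right)
    have "path M \<W> (g' \<otimes> f) (lwhisker g' xs) (g' \<otimes> f')"
        "path M \<W> (g' \<otimes> f) (lwhisker g' xs') (g' \<otimes> f')"
        "path M \<W> (g \<otimes> f) (rwhisker ys f) (g' \<otimes> f)" "path M \<W> (g \<otimes> f) (rwhisker ys' f) (g' \<otimes> f)"
      using path_lwhisker[OF xs] path_lwhisker[OF zigzag_eq_path(2)[OF xs']]
        path_rwhisker[OF ys] path_rwhisker[OF zigzag_eq_path(2)[OF ys']] arrs gf by auto
    then show ?thesis
      using vcomp_zclass[of "g \<otimes> f" "rwhisker ys f" "g' \<otimes> f" "lwhisker g' xs" "g' \<otimes> f'"]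
        vcomp_zclass[of "g \<otimes> f" "rwhisker ys' f" "g' \<otimes> f" "lwhisker g' xs'" "g' \<otimes> f'"]
        zclass_eqI[OF l] zclass_eqI[OF r] by simp
  qed
  have "{zclass (k \<otimes> e) (rwhisker ys' e @ lwhisker k' xs') (k' \<otimes> e') | e xs' e' k ys' k'.
      (e, xs', e') \<in> zclass f xs f' \<and> (k, ys', k') \<in> zclass g ys g'}
    = {zclass (g \<otimes> f) (rwhisker ys f @ lwhisker g' xs) (g' \<otimes> f')}" (is "?S = {?Z}")
  proof
    show "?S \<subseteq> {?Z}"
    proof
      fix T assume "T \<in> ?S"
      then obtain e xs' e' k ys' k' where T: "T = zclass (k \<otimes> e) (rwhisker ys' e @ lwhisker k' xs') (k' \<otimes> e')"
        "(e, xs', e') \<in> zclass f xs f'" "(k, ys', k') \<in> zclass g ys g'" by blast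
      show "T \<in> {?Z}"
        using T(1) zclass_member[OF T(2)] zclass_member[OF T(3)] eq by simp
    qed
    show "{?Z} \<subseteq> ?S"
      using zclass_refl[OF xs] zclass_refl[OF ys] by blast
  qed
  then show ?thesis
    unfolding localization_def by simp
qed

lemma hcomp_Loc_simps [simp]:
  assumes "X \<in> cells Loc" "Y \<in> cells Loc" "src M (dom2 Loc Y) = trg M (dom2 Loc X)"
  shows "Y \<boxtimes>\<^bsub>Loc\<^esub> X \<in> cells Loc" "dom2 Loc (Y \<boxtimes>\<^bsub>Loc\<^esub> X) = dom2 Loc Y \<otimes> dom2 Loc X"
    "cod2 Loc (Y \<boxtimes>\<^bsub>Loc\<^esub> X) = cod2 Loc Y \<otimes> cod2 Loc X"
proof -
  obtain f xs f' g ys g' where *: "X = zclass f xs f'" "path M \<W> f xs f'" "Y = zclass g ys g'" "path M \<W> g ys g'"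
    using assms by (auto simp: cells_Loc)
  moreover from * have "src M g = trg M f" using assms by simp
  moreover from this * have "path M \<W> (g \<otimes> f) (rwhisker ys f @ lwhisker g' xs) (g' \<otimes> f')"
    using path_arrs[of f xs f'] path_arrs[of g ys g']
    by (intro path_appendI[of _ _ "g' \<otimes> f"] path_lwhisker path_rwhisker) auto
  ultimately show "Y \<boxtimes>\<^bsub>Loc\<^esub> X \<in> cells Loc" "dom2 Loc (Y \<boxtimes>\<^bsub>Loc\<^esub> X) = dom2 Loc Y \<otimes> dom2 Loc X"
    "cod2 Loc (Y \<boxtimes>\<^bsub>Loc\<^esub> X) = cod2 Loc Y \<otimes> cod2 Loc X"
    by (simp_all add: hcomp_zclass)
qed

lemma hcomp_Loc_id2 [simp]:
  "f \<in> arrs M \<Longrightarrow> g \<in> arrs M \<Longrightarrow> src M g = trg M f \<Longrightarrow> id2 Loc g \<boxtimes>\<^bsub>Loc\<^esub> id2 Loc f = id2 Loc (g \<otimes> f)"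
  by (simp add: id2_Loc hcomp_zclass)

text \<open>An identity cell is represented by the empty list, so only one of the two halves of the
  horizontal composite survives. Whiskering then becomes a map over lists, and its functoriality is
  distributivity of \<open>map\<close> over concatenation.\<close>

lemma whisker_left_Loc:
  assumes "path M \<W> f xs f'" "g \<in> arrs M" "src M g = trg M f"
  shows "id2 Loc g \<boxtimes>\<^bsub>Loc\<^esub> zclass f xs f' = zclass (g \<otimes> f) (lwhisker g xs) (g \<otimes> f')"
  using assms by (simp add: id2_Loc hcomp_zclass)

lemma whisker_right_Loc:
  assumes "path M \<W> g ys g'" "f \<in> arrs M" "src M g = trg M f"
  shows "zclass g ys g' \<boxtimes>\<^bsub>Loc\<^esub> id2 Loc f = zclass (g \<otimes> f) (rwhisker ys f) (g' \<otimes> f)"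
  using assms by (simp add: id2_Loc hcomp_zclass)

lemma whisker_left_Loc_vcomp:
  assumes "X \<in> cells Loc" "Y \<in> cells Loc" "dom2 Loc Y = cod2 Loc X" "g \<in> arrs M" "src M g = trg M (dom2 Loc X)"
  shows "id2 Loc g \<boxtimes>\<^bsub>Loc\<^esub> (Y \<star>\<^bsub>Loc\<^esub> X) = (id2 Loc g \<boxtimes>\<^bsub>Loc\<^esub> Y) \<star>\<^bsub>Loc\<^esub> (id2 Loc g \<boxtimes>\<^bsub>Loc\<^esub> X)"
proof -
  obtain f xs f' ys f'' where *: "X = zclass f xs f'" "path M \<W> f xs f'" "Y = zclass f' ys f''" "path M \<W> f' ys f''"
    using assms by (auto simp: cells_Loc)
  moreover from * have "src M g = trg M f" "src M g = trg M f'"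
    using assms path_arrs[of f xs f'] by auto
  ultimately show ?thesis
    using assms(4) by (simp add: vcomp_zclass whisker_left_Loc path_lwhisker path_appendI)
qed

lemma whisker_right_Loc_vcomp:
  assumes "X \<in> cells Loc" "Y \<in> cells Loc" "dom2 Loc Y = cod2 Loc X" "f \<in> arrs M" "trg M f = src M (dom2 Loc X)"
  shows "(Y \<star>\<^bsub>Loc\<^esub> X) \<boxtimes>\<^bsub>Loc\<^esub> id2 Loc f = (Y \<boxtimes>\<^bsub>Loc\<^esub> id2 Loc f) \<star>\<^bsub>Loc\<^esub> (X \<boxtimes>\<^bsub>Loc\<^esub> id2 Loc f)"
proof -
  obtain g xs g' ys g'' where *: "X = zclass g xs g'" "path M \<W> g xs g'" "Y = zclass g' ys g''" "path M \<W> g' ys g''"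
    using assms by (auto simp: cells_Loc)
  moreover from * have "src M g = trg M f" "src M g' = trg M f"
    using assms path_arrs[of g xs g'] by auto
  ultimately show ?thesis
    using assms(4) by (simp add: vcomp_zclass whisker_right_Loc path_rwhisker path_appendI)
qed

lemma hcomp_Loc_eq:
  assumes "X \<in> cells Loc" "Y \<in> cells Loc" "src M (dom2 Loc Y) = trg M (dom2 Loc X)"
  shows "Y \<boxtimes>\<^bsub>Loc\<^esub> X = (id2 Loc (cod2 Loc Y) \<boxtimes>\<^bsub>Loc\<^esub> X) \<star>\<^bsub>Loc\<^esub> (Y \<boxtimes>\<^bsub>Loc\<^esub> id2 Loc (dom2 Loc X))"
proof -
  obtain f xs f' g ys g' where *: "X = zclass f xs f'" "path M \<W> f xs f'" "Y = zclass g ys g'" "path M \<W> g ys g'"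
    using assms by (auto simp: cells_Loc)
  moreover from * have "src M g = trg M f" "src M g' = trg M f" "f \<in> arrs M" "g' \<in> arrs M"
    using assms path_arrs[of g ys g'] path_arrs[of f xs f'] by auto
  ultimately show ?thesis
    by (simp add: vcomp_zclass whisker_left_Loc whisker_right_Loc hcomp_zclass path_lwhisker path_rwhisker)
qed

lemma fwd_class_whisker:
  assumes "\<alpha> \<in> cells M" "g \<in> arrs M"
  shows "src M g = trg M (dom2 M \<alpha>) \<Longrightarrow>
      id2 Loc g \<boxtimes>\<^bsub>Loc\<^esub> fwd_class M \<W> \<alpha> = fwd_class M \<W> (id2 M g \<boxtimes> \<alpha>)"
    "trg M g = src M (dom2 M \<alpha>) \<Longrightarrow>
      fwd_class M \<W> \<alpha> \<boxtimes>\<^bsub>Loc\<^esub> id2 Loc g = fwd_class M \<W> (\<alpha> \<boxtimes> id2 M g)"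
  using assms by (simp_all add: fwd_class_eq whisker_left_Loc whisker_right_Loc)

section \<open>Interchange and naturality of the constraint cells\<close>

lemma hom_functor_Loc_whisker_left:
  "g \<in> arrs M \<Longrightarrow> src M g = V \<Longrightarrow> hom_functor Loc U V Loc (\<lambda>f. g \<otimes> f) (\<lambda>X. id2 Loc g \<boxtimes>\<^bsub>Loc\<^esub> X)"
  by (auto simp: hom_functor_def hom1_iff hom2_iff whisker_left_Loc_vcomp)

lemma hom_functor_Loc_whisker_right:
  "f \<in> arrs M \<Longrightarrow> trg M f = U \<Longrightarrow> hom_functor Loc U V Loc (\<lambda>g. g \<otimes> f) (\<lambda>Y. Y \<boxtimes>\<^bsub>Loc\<^esub> id2 Loc f)"
  by (auto simp: hom_functor_def hom1_iff hom2_iff whisker_right_Loc_vcomp)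

text \<open>This says that the order chosen in the definition of horizontal composition is
  immaterial. Two nested extensions from 2-cells to zigzags reduce it to the case where both cells
  are forward classes, which is interchange in \<open>M\<close>.\<close>

lemma whisker_exchange:
  assumes X: "X \<in> cells Loc" and Y: "Y \<in> cells Loc" and YX: "src M (dom2 Loc Y) = trg M (dom2 Loc X)"
  shows "(Y \<boxtimes>\<^bsub>Loc\<^esub> id2 Loc (cod2 Loc X)) \<star>\<^bsub>Loc\<^esub> (id2 Loc (dom2 Loc Y) \<boxtimes>\<^bsub>Loc\<^esub> X)
    = (id2 Loc (cod2 Loc Y) \<boxtimes>\<^bsub>Loc\<^esub> X) \<star>\<^bsub>Loc\<^esub> (Y \<boxtimes>\<^bsub>Loc\<^esub> id2 Loc (dom2 Loc X))"
proof -
  define U V W where "U = src M (dom2 Loc X)" and "V = trg M (dom2 Loc X)" and "W = trg M (dom2 Loc Y)"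
  \<comment> \<open>With \<alpha> fixed, whiskering its class on the left gives a transformation
    between the right whiskerings with the domain and with the codomain of \<alpha>; it is natural
    in \<open>Y\<close>.\<close>
  have fwd: "(Y \<boxtimes>\<^bsub>Loc\<^esub> id2 Loc (cod2 M \<alpha>)) \<star>\<^bsub>Loc\<^esub> (id2 Loc (dom2 Loc Y) \<boxtimes>\<^bsub>Loc\<^esub> fwd_class M \<W> \<alpha>)
      = (id2 Loc (cod2 Loc Y) \<boxtimes>\<^bsub>Loc\<^esub> fwd_class M \<W> \<alpha>) \<star>\<^bsub>Loc\<^esub> (Y \<boxtimes>\<^bsub>Loc\<^esub> id2 Loc (dom2 M \<alpha>))"
    if \<alpha>: "\<alpha> \<in> cells M" "dom2 M \<alpha> \<in> hom1 M U V" for \<alpha>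
  proof (rule natural_extend[OF L.vertical_category_axioms hom_functor_Loc_whisker_right
        hom_functor_Loc_whisker_right, of "dom2 M \<alpha>" V "cod2 M \<alpha>" W, symmetric])
    fix \<beta> assume "\<beta> \<in> cells M" "dom2 M \<beta> \<in> hom1 M V W"
    then show "(id2 Loc (cod2 M \<beta>) \<boxtimes>\<^bsub>Loc\<^esub> fwd_class M \<W> \<alpha>) \<star>\<^bsub>Loc\<^esub> (fwd_class M \<W> \<beta> \<boxtimes>\<^bsub>Loc\<^esub> id2 Loc (dom2 M \<alpha>))
      = (fwd_class M \<W> \<beta> \<boxtimes>\<^bsub>Loc\<^esub> id2 Loc (cod2 M \<alpha>)) \<star>\<^bsub>Loc\<^esub> (id2 Loc (dom2 M \<beta>) \<boxtimes>\<^bsub>Loc\<^esub> fwd_class M \<W> \<alpha>)"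
      using \<alpha> by (simp add: hom1_iff fwd_class_whisker fwd_class_vcomp interchange')
  qed (use \<alpha> Y YX in \<open>auto simp: hom1_iff hom2_iff V_def W_def\<close>)
  \<comment> \<open>Now \<open>Y\<close> is fixed and its right whiskerings form a transformation
    between the left whiskerings with its domain and with its codomain; the forward case is
    \<open>fwd\<close>.\<close>
  show ?thesis
  proof (rule natural_extend[OF L.vertical_category_axioms hom_functor_Loc_whisker_left
        hom_functor_Loc_whisker_left, of "dom2 Loc Y" V "cod2 Loc Y" U])
  qed (use X Y YX fwd in \<open>auto simp: hom1_iff hom2_iff U_def V_def\<close>)
qed

text \<open>When each horizontal composite is written as a right whiskering followed by a left
  whiskering, the two sides differ only in the order of \<open>X\<close> and \<open>Y'\<close>,
  which the exchange law corrects.\<close>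

lemma interchange_Loc:
  assumes "X \<in> cells Loc" "X' \<in> cells Loc" "dom2 Loc X' = cod2 Loc X"
    "Y \<in> cells Loc" "Y' \<in> cells Loc" "dom2 Loc Y' = cod2 Loc Y" "src M (dom2 Loc Y) = trg M (dom2 Loc X)"
  shows "(Y' \<star>\<^bsub>Loc\<^esub> Y) \<boxtimes>\<^bsub>Loc\<^esub> (X' \<star>\<^bsub>Loc\<^esub> X) = (Y' \<boxtimes>\<^bsub>Loc\<^esub> X') \<star>\<^bsub>Loc\<^esub> (Y \<boxtimes>\<^bsub>Loc\<^esub> X)"
proof -
  let ?f = "dom2 Loc X" and ?f' = "cod2 Loc X" and ?g' = "cod2 Loc Y" and ?g'' = "cod2 Loc Y'"
  have ex: "(id2 Loc ?g'' \<boxtimes>\<^bsub>Loc\<^esub> X) \<star>\<^bsub>Loc\<^esub> ((Y' \<boxtimes>\<^bsub>Loc\<^esub> id2 Loc ?f) \<star>\<^bsub>Loc\<^esub> (Y \<boxtimes>\<^bsub>Loc\<^esub> id2 Loc ?f))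
    = (Y' \<boxtimes>\<^bsub>Loc\<^esub> id2 Loc ?f') \<star>\<^bsub>Loc\<^esub> ((id2 Loc ?g' \<boxtimes>\<^bsub>Loc\<^esub> X) \<star>\<^bsub>Loc\<^esub> (Y \<boxtimes>\<^bsub>Loc\<^esub> id2 Loc ?f))"
    using whisker_exchange[of X Y'] assms by (intro L.vcomp_eq_reassoc) simp_all
  have "(Y' \<star>\<^bsub>Loc\<^esub> Y) \<boxtimes>\<^bsub>Loc\<^esub> (X' \<star>\<^bsub>Loc\<^esub> X)
      = (id2 Loc ?g'' \<boxtimes>\<^bsub>Loc\<^esub> (X' \<star>\<^bsub>Loc\<^esub> X)) \<star>\<^bsub>Loc\<^esub> ((Y' \<star>\<^bsub>Loc\<^esub> Y) \<boxtimes>\<^bsub>Loc\<^esub> id2 Loc ?f)"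
    using hcomp_Loc_eq[of "X' \<star>\<^bsub>Loc\<^esub> X" "Y' \<star>\<^bsub>Loc\<^esub> Y"] assms by simp
  also have "\<dots> = ((id2 Loc ?g'' \<boxtimes>\<^bsub>Loc\<^esub> X') \<star>\<^bsub>Loc\<^esub> (Y' \<boxtimes>\<^bsub>Loc\<^esub> id2 Loc ?f')) \<star>\<^bsub>Loc\<^esub>
      ((id2 Loc ?g' \<boxtimes>\<^bsub>Loc\<^esub> X) \<star>\<^bsub>Loc\<^esub> (Y \<boxtimes>\<^bsub>Loc\<^esub> id2 Loc ?f))"
    using assms by (simp add: whisker_left_Loc_vcomp whisker_right_Loc_vcomp ex)
  also have "\<dots> = (Y' \<boxtimes>\<^bsub>Loc\<^esub> X') \<star>\<^bsub>Loc\<^esub> (Y \<boxtimes>\<^bsub>Loc\<^esub> X)"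
    using hcomp_Loc_eq[of X Y] hcomp_Loc_eq[of X' Y'] assms by simp
  finally show ?thesis .
qed

text \<open>Both threefold composites factor as a whiskering of \<open>Z\<close>, then of
  \<open>Y\<close>, then of \<open>X\<close>, and the associator is moved past these factors in
  turn, starting with \<open>X\<close>. For a single factor the functors are iterated whiskerings,
  and the forward case is naturality in \<open>M\<close> with the other two arguments
  identities.\<close>

lemma associator_Loc_natural:
  assumes X: "X \<in> cells Loc" and Y: "Y \<in> cells Loc" and Z: "Z \<in> cells Loc"
    and YX: "src M (dom2 Loc Y) = trg M (dom2 Loc X)" and ZY: "src M (dom2 Loc Z) = trg M (dom2 Loc Y)"
  shows "associator Loc (cod2 Loc Z) (cod2 Loc Y) (cod2 Loc X) \<star>\<^bsub>Loc\<^esub> ((Z \<boxtimes>\<^bsub>Loc\<^esub> Y) \<boxtimes>\<^bsub>Loc\<^esub> X)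
    = (Z \<boxtimes>\<^bsub>Loc\<^esub> (Y \<boxtimes>\<^bsub>Loc\<^esub> X)) \<star>\<^bsub>Loc\<^esub> associator Loc (dom2 Loc Z) (dom2 Loc Y) (dom2 Loc X)"
proof -
  let ?a = "\<lambda>h g f. fwd_class M \<W> (associator M h g f)" and ?i = "id2 Loc"
  let ?f = "dom2 Loc X" and ?g = "dom2 Loc Y" and ?h = "dom2 Loc Z"
  let ?f' = "cod2 Loc X" and ?g' = "cod2 Loc Y" and ?h' = "cod2 Loc Z"
  have nat_X: "?a h g ?f' \<star>\<^bsub>Loc\<^esub> (?i (h \<otimes> g) \<boxtimes>\<^bsub>Loc\<^esub> X) = (?i h \<boxtimes>\<^bsub>Loc\<^esub> (?i g \<boxtimes>\<^bsub>Loc\<^esub> X)) \<star>\<^bsub>Loc\<^esub> ?a h g ?f"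
    if "g \<in> arrs M" "h \<in> arrs M" "src M g = trg M ?f" "src M h = trg M g" for g h
  proof (rule natural_extend[OF L.vertical_category_axioms, where U="src M ?f" and V="trg M ?f"
      and F\<^sub>0="\<lambda>f. (h \<otimes> g) \<otimes> f" and G\<^sub>0="\<lambda>f. h \<otimes> (g \<otimes> f)"])
    fix \<alpha> assume "\<alpha> \<in> cells M" "dom2 M \<alpha> \<in> hom1 M (src M ?f) (trg M ?f)"
    then show "?a h g (cod2 M \<alpha>) \<star>\<^bsub>Loc\<^esub> (?i (h \<otimes> g) \<boxtimes>\<^bsub>Loc\<^esub> fwd_class M \<W> \<alpha>)
        = (?i h \<boxtimes>\<^bsub>Loc\<^esub> (?i g \<boxtimes>\<^bsub>Loc\<^esub> fwd_class M \<W> \<alpha>)) \<star>\<^bsub>Loc\<^esub> ?a h g (dom2 M \<alpha>)"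
      using associator_natural'[of \<alpha> "id2 M g" "id2 M h"] that
      by (simp add: hom1_iff fwd_class_whisker fwd_class_vcomp)
  qed (use that X in \<open>auto simp: hom_functor_def hom1_iff hom2_iff whisker_left_Loc_vcomp\<close>)
  have nat_Y: "?a h ?g' f \<star>\<^bsub>Loc\<^esub> ((?i h \<boxtimes>\<^bsub>Loc\<^esub> Y) \<boxtimes>\<^bsub>Loc\<^esub> ?i f) = (?i h \<boxtimes>\<^bsub>Loc\<^esub> (Y \<boxtimes>\<^bsub>Loc\<^esub> ?i f)) \<star>\<^bsub>Loc\<^esub> ?a h ?g f"
    if "f \<in> arrs M" "h \<in> arrs M" "src M ?g = trg M f" "src M h = trg M ?g" for f h
  proof (rule natural_extend[OF L.vertical_category_axioms, where U="src M ?g" and V="trg M ?g"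
      and F\<^sub>0="\<lambda>g. (h \<otimes> g) \<otimes> f" and G\<^sub>0="\<lambda>g. h \<otimes> (g \<otimes> f)"])
    fix \<beta> assume "\<beta> \<in> cells M" "dom2 M \<beta> \<in> hom1 M (src M ?g) (trg M ?g)"
    then show "?a h (cod2 M \<beta>) f \<star>\<^bsub>Loc\<^esub> ((?i h \<boxtimes>\<^bsub>Loc\<^esub> fwd_class M \<W> \<beta>) \<boxtimes>\<^bsub>Loc\<^esub> ?i f)
        = (?i h \<boxtimes>\<^bsub>Loc\<^esub> (fwd_class M \<W> \<beta> \<boxtimes>\<^bsub>Loc\<^esub> ?i f)) \<star>\<^bsub>Loc\<^esub> ?a h (dom2 M \<beta>) f"
      using associator_natural'[of "id2 M f" \<beta> "id2 M h"] that
      by (simp add: hom1_iff fwd_class_whisker fwd_class_vcomp)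
  qed (use that Y in \<open>auto simp: hom_functor_def hom1_iff hom2_iff whisker_left_Loc_vcomp whisker_right_Loc_vcomp\<close>)
  have nat_Z: "?a ?h' g f \<star>\<^bsub>Loc\<^esub> ((Z \<boxtimes>\<^bsub>Loc\<^esub> ?i g) \<boxtimes>\<^bsub>Loc\<^esub> ?i f) = (Z \<boxtimes>\<^bsub>Loc\<^esub> ?i (g \<otimes> f)) \<star>\<^bsub>Loc\<^esub> ?a ?h g f"
    if "f \<in> arrs M" "g \<in> arrs M" "src M g = trg M f" "src M ?h = trg M g" for f g
  proof (rule natural_extend[OF L.vertical_category_axioms, where U="src M ?h" and V="trg M ?h"
      and F\<^sub>0="\<lambda>h. (h \<otimes> g) \<otimes> f" and G\<^sub>0="\<lambda>h. h \<otimes> (g \<otimes> f)"])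
    fix \<gamma> assume "\<gamma> \<in> cells M" "dom2 M \<gamma> \<in> hom1 M (src M ?h) (trg M ?h)"
    then show "?a (cod2 M \<gamma>) g f \<star>\<^bsub>Loc\<^esub> ((fwd_class M \<W> \<gamma> \<boxtimes>\<^bsub>Loc\<^esub> ?i g) \<boxtimes>\<^bsub>Loc\<^esub> ?i f)
        = (fwd_class M \<W> \<gamma> \<boxtimes>\<^bsub>Loc\<^esub> ?i (g \<otimes> f)) \<star>\<^bsub>Loc\<^esub> ?a (dom2 M \<gamma>) g f"
      using associator_natural'[of "id2 M f" "id2 M g" \<gamma>] that
      by (simp add: hom1_iff fwd_class_whisker fwd_class_vcomp)
  qed (use that Z in \<open>auto simp: hom_functor_def hom1_iff hom2_iff whisker_right_Loc_vcomp\<close>)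
  note [simp] = X Y Z YX ZY
  have "?a ?h' ?g' ?f' \<star>\<^bsub>Loc\<^esub> ((Z \<boxtimes>\<^bsub>Loc\<^esub> Y) \<boxtimes>\<^bsub>Loc\<^esub> X)
    = ?a ?h' ?g' ?f' \<star>\<^bsub>Loc\<^esub> ((?i (?h' \<otimes> ?g') \<boxtimes>\<^bsub>Loc\<^esub> X) \<star>\<^bsub>Loc\<^esub> (((?i ?h' \<boxtimes>\<^bsub>Loc\<^esub> Y) \<boxtimes>\<^bsub>Loc\<^esub> ?i ?f) \<star>\<^bsub>Loc\<^esub>
        ((Z \<boxtimes>\<^bsub>Loc\<^esub> ?i ?g) \<boxtimes>\<^bsub>Loc\<^esub> ?i ?f)))"
    using hcomp_Loc_eq[of X "Z \<boxtimes>\<^bsub>Loc\<^esub> Y"] hcomp_Loc_eq[of Y Z] by (simp add: whisker_right_Loc_vcomp)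
  also have "\<dots> = (?i ?h' \<boxtimes>\<^bsub>Loc\<^esub> (?i ?g' \<boxtimes>\<^bsub>Loc\<^esub> X)) \<star>\<^bsub>Loc\<^esub> (?a ?h' ?g' ?f \<star>\<^bsub>Loc\<^esub> (((?i ?h' \<boxtimes>\<^bsub>Loc\<^esub> Y) \<boxtimes>\<^bsub>Loc\<^esub> ?i ?f) \<star>\<^bsub>Loc\<^esub>
        ((Z \<boxtimes>\<^bsub>Loc\<^esub> ?i ?g) \<boxtimes>\<^bsub>Loc\<^esub> ?i ?f)))"
    by (intro L.vcomp_eq_reassoc nat_X) simp_all
  also have "?a ?h' ?g' ?f \<star>\<^bsub>Loc\<^esub> (((?i ?h' \<boxtimes>\<^bsub>Loc\<^esub> Y) \<boxtimes>\<^bsub>Loc\<^esub> ?i ?f) \<star>\<^bsub>Loc\<^esub> ((Z \<boxtimes>\<^bsub>Loc\<^esub> ?i ?g) \<boxtimes>\<^bsub>Loc\<^esub> ?i ?f))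
    = (?i ?h' \<boxtimes>\<^bsub>Loc\<^esub> (Y \<boxtimes>\<^bsub>Loc\<^esub> ?i ?f)) \<star>\<^bsub>Loc\<^esub> (?a ?h' ?g ?f \<star>\<^bsub>Loc\<^esub> ((Z \<boxtimes>\<^bsub>Loc\<^esub> ?i ?g) \<boxtimes>\<^bsub>Loc\<^esub> ?i ?f))"
    by (intro L.vcomp_eq_reassoc nat_Y) simp_all
  also have "?a ?h' ?g ?f \<star>\<^bsub>Loc\<^esub> ((Z \<boxtimes>\<^bsub>Loc\<^esub> ?i ?g) \<boxtimes>\<^bsub>Loc\<^esub> ?i ?f) = (Z \<boxtimes>\<^bsub>Loc\<^esub> ?i (?g \<otimes> ?f)) \<star>\<^bsub>Loc\<^esub> ?a ?h ?g ?f"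
    by (intro nat_Z) simp_all
  also have "(?i ?h' \<boxtimes>\<^bsub>Loc\<^esub> (?i ?g' \<boxtimes>\<^bsub>Loc\<^esub> X)) \<star>\<^bsub>Loc\<^esub> ((?i ?h' \<boxtimes>\<^bsub>Loc\<^esub> (Y \<boxtimes>\<^bsub>Loc\<^esub> ?i ?f)) \<star>\<^bsub>Loc\<^esub>
      ((Z \<boxtimes>\<^bsub>Loc\<^esub> ?i (?g \<otimes> ?f)) \<star>\<^bsub>Loc\<^esub> ?a ?h ?g ?f)) = (Z \<boxtimes>\<^bsub>Loc\<^esub> (Y \<boxtimes>\<^bsub>Loc\<^esub> X)) \<star>\<^bsub>Loc\<^esub> ?a ?h ?g ?f"
    using hcomp_Loc_eq[of "Y \<boxtimes>\<^bsub>Loc\<^esub> X" Z] hcomp_Loc_eq[of X Y] by (simp add: whisker_left_Loc_vcomp)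
  finally show ?thesis by simp
qed

text \<open>The unitor is a transformation from whiskering with a unit 1-cell to the identity
  functor of a hom-category, so its naturality extends from the image of \<open>M\<close>.\<close>

lemma lunitor_Loc_natural:
  assumes "X \<in> cells Loc"
  shows "lunitor Loc (cod2 Loc X) \<star>\<^bsub>Loc\<^esub> (id2 Loc (id1 M (trg M (dom2 Loc X))) \<boxtimes>\<^bsub>Loc\<^esub> X)
    = X \<star>\<^bsub>Loc\<^esub> lunitor Loc (dom2 Loc X)"
proof (rule natural_extend[OF L.vertical_category_axioms, where G="\<lambda>X. X" and G\<^sub>0="\<lambda>f. f"
      and \<tau>="lunitor Loc" and F="\<lambda>Y. id2 Loc (id1 M (trg M (dom2 Loc X))) \<boxtimes>\<^bsub>Loc\<^esub> Y"
      and F\<^sub>0="\<lambda>f. id1 M (trg M (dom2 Loc X)) \<otimes> f" and U="src M (dom2 Loc X)" and V="trg M (dom2 Loc X)"])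
  fix \<alpha> assume "\<alpha> \<in> cells M" "dom2 M \<alpha> \<in> hom1 M (src M (dom2 Loc X)) (trg M (dom2 Loc X))"
  then show "lunitor Loc (cod2 M \<alpha>) \<star>\<^bsub>Loc\<^esub> (id2 Loc (id1 M (trg M (dom2 Loc X))) \<boxtimes>\<^bsub>Loc\<^esub> fwd_class M \<W> \<alpha>)
      = fwd_class M \<W> \<alpha> \<star>\<^bsub>Loc\<^esub> lunitor Loc (dom2 M \<alpha>)"
    using lunitor_natural'[of \<alpha>] assms by (auto simp: hom1_iff fwd_class_whisker fwd_class_vcomp)
qed (use assms in \<open>auto simp: hom_functor_def hom1_iff hom2_iff whisker_left_Loc_vcomp\<close>)

lemma runitor_Loc_natural:
  assumes "X \<in> cells Loc"
  shows "runitor Loc (cod2 Loc X) \<star>\<^bsub>Loc\<^esub> (X \<boxtimes>\<^bsub>Loc\<^esub> id2 Loc (id1 M (src M (dom2 Loc X))))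
    = X \<star>\<^bsub>Loc\<^esub> runitor Loc (dom2 Loc X)"
proof (rule natural_extend[OF L.vertical_category_axioms, where G="\<lambda>X. X" and G\<^sub>0="\<lambda>f. f"
      and \<tau>="runitor Loc" and F="\<lambda>Y. Y \<boxtimes>\<^bsub>Loc\<^esub> id2 Loc (id1 M (src M (dom2 Loc X)))"
      and F\<^sub>0="\<lambda>f. f \<otimes> id1 M (src M (dom2 Loc X))" and U="src M (dom2 Loc X)" and V="trg M (dom2 Loc X)"])
  fix \<alpha> assume "\<alpha> \<in> cells M" "dom2 M \<alpha> \<in> hom1 M (src M (dom2 Loc X)) (trg M (dom2 Loc X))"
  then show "runitor Loc (cod2 M \<alpha>) \<star>\<^bsub>Loc\<^esub> (fwd_class M \<W> \<alpha> \<boxtimes>\<^bsub>Loc\<^esub> id2 Loc (id1 M (src M (dom2 Loc X))))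
      = fwd_class M \<W> \<alpha> \<star>\<^bsub>Loc\<^esub> runitor Loc (dom2 M \<alpha>)"
    using runitor_natural'[of \<alpha>] assms by (auto simp: hom1_iff fwd_class_whisker fwd_class_vcomp)
qed (use assms in \<open>auto simp: hom_functor_def hom1_iff hom2_iff whisker_right_Loc_vcomp\<close>)

text \<open>In the pentagon and the triangle all constraint cells are forward classes, and
  whiskering and vertical composition of forward classes are computed in \<open>M\<close>; both laws
  are images of those of \<open>M\<close>.\<close>

lemma bicategory_Loc: "bicategory Loc"
proof (unfold_locales, goal_cases)
  case (16 \<alpha> f f' \<alpha>' f'' \<beta> g g' \<beta>' g'')
  then show ?case using interchange_Loc[of \<alpha> \<alpha>' \<beta> \<beta>'] by (auto simp: hom2_iff)
next
  case (19 X f f' Y g g' Z h h')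
  then show ?case using associator_Loc_natural[of X Y Z] by (auto simp: hom2_iff)
next
  case (22 X f g)
  then show ?case using lunitor_Loc_natural[of X] by (auto simp: hom2_iff)
next
  case (25 X f g)
  then show ?case using runitor_Loc_natural[of X] by (auto simp: hom2_iff)
next
  case (26 f U V g W h X k Y)
  then show ?case
    using pentagon'[of f g h k] by (auto simp: hom1_iff fwd_class_whisker fwd_class_vcomp)
next
  case (27 f U V g W)
  then show ?case
    using triangle'[of f g] by (auto simp: hom1_iff fwd_class_whisker fwd_class_vcomp)
qed (auto simp: hom1_iff hom2_iff)

end

section \<open>The universal property\<close>

context base_of_enrichment
begin

sublocale L: bicategory Loc
  by (rule bicategory_Loc)

lemma fwd_class_hcomp:
  assumes "\<alpha> \<in> cells M" "\<beta> \<in> cells M" "src M (dom2 M \<beta>) = trg M (dom2 M \<alpha>)"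
  shows "fwd_class M \<W> \<beta> \<boxtimes>\<^bsub>Loc\<^esub> fwd_class M \<W> \<alpha> = fwd_class M \<W> (\<beta> \<boxtimes> \<alpha>)"
  using hcomp_Loc_eq[of "fwd_class M \<W> \<alpha>" "fwd_class M \<W> \<beta>"] assms
  by (simp add: fwd_class_whisker fwd_class_vcomp interchange')

lemma homomorphism_localization_hom: "homomorphism M Loc (localization_hom M \<W>)"
  by unfold_locales
    (auto simp: localization_hom_def hom1_iff hom2_iff fwd_class_id2 fwd_class_vcomp fwd_class_hcomp)

text \<open>Agreement of the composites gives agreement only on forward classes; the cells produced
  by inverting \<open>\<W>\<close> are reached by extending a naturality square.\<close>

lemma eq_hom_on_fwd_class:
  assumes "homomorphism Loc B \<Phi>" "homomorphism Loc B \<Psi>"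
    and eq: "eq_hom M (comp_hom B \<Phi> (localization_hom M \<W>)) (comp_hom B \<Psi> (localization_hom M \<W>))"
  shows "eq_hom Loc \<Phi> \<Psi>"
proof -
  interpret \<Phi>: homomorphism Loc B \<Phi> by fact
  interpret \<Psi>: homomorphism Loc B \<Psi> by fact
  have obj: "\<And>A. A \<in> objs M \<Longrightarrow> on_obj \<Phi> A = on_obj \<Psi> A"
    and arr: "\<And>f. f \<in> arrs M \<Longrightarrow> on_arr \<Phi> f = on_arr \<Psi> f"
    and fwd: "\<And>\<alpha>. \<alpha> \<in> cells M \<Longrightarrow> on_cell \<Phi> (fwd_class M \<W> \<alpha>) = on_cell \<Psi> (fwd_class M \<W> \<alpha>)"
    using eq by (auto simp: eq_hom_def comp_hom_def localization_hom_def)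
  have cell: "on_cell \<Phi> X = on_cell \<Psi> X" if X: "X \<in> cells Loc" for X
  proof -
    let ?U = "src M (dom2 Loc X)" and ?V = "trg M (dom2 Loc X)"
    \<comment> \<open>The transformation has identity components, which are well typed since \<Phi>
      and \<Psi> agree on 1-cells; its naturality square is exactly the equality wanted.\<close>
    have "id2 B (on_arr \<Phi> (cod2 Loc X)) \<star>\<^bsub>B\<^esub> on_cell \<Phi> X = on_cell \<Psi> X \<star>\<^bsub>B\<^esub> id2 B (on_arr \<Phi> (dom2 Loc X))"
    proof (rule natural_extend[OF \<Phi>.B.vertical_category_axioms, of ?U ?V "on_arr \<Phi>" _ "on_arr \<Psi>"])
      show "hom_functor Loc ?U ?V B (on_arr \<Phi>) (on_cell \<Phi>)"
        by (auto simp: hom_functor_def hom1_iff hom2_iff)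
      show "hom_functor Loc ?U ?V B (on_arr \<Psi>) (on_cell \<Psi>)"
        by (auto simp: hom_functor_def hom1_iff hom2_iff)
    qed (use X \<Phi>.on_arr_simps(1) in \<open>auto simp: hom1_iff hom2_iff fwd arr\<close>)
    then show ?thesis using X \<Phi>.on_cell_simps[of X] \<Psi>.on_cell_simps[of X] by (simp add: arr)
  qed
  have comp: "on_comp \<Phi> g f = on_comp \<Psi> g f" if "f \<in> arrs M" "g \<in> arrs M" "src M g = trg M f" for f g
  proof -
    \<comment> \<open>The comparison cells of the localization homomorphism are identities, so a
      comparison cell of the composite is that of \<Phi> times an identity.\<close>
    have "on_cell \<Phi> (id2 Loc (g \<otimes> f)) \<star>\<^bsub>B\<^esub> on_comp \<Phi> g f = on_cell \<Psi> (id2 Loc (g \<otimes> f)) \<star>\<^bsub>B\<^esub> on_comp \<Psi> g f"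
      using eq that by (simp add: eq_hom_def comp_hom_def localization_hom_def fwd_class_id2)
    then show ?thesis
      using that \<Phi>.on_comp_simps[of f g] \<Psi>.on_comp_simps[of f g] by simp
  qed
  have "on_unit \<Phi> A = on_unit \<Psi> A" if "A \<in> objs M" for A
  proof -
    have "on_cell \<Phi> (id2 Loc (id1 M A)) \<star>\<^bsub>B\<^esub> on_unit \<Phi> A = on_cell \<Psi> (id2 Loc (id1 M A)) \<star>\<^bsub>B\<^esub> on_unit \<Psi> A"
      using eq that by (simp add: eq_hom_def comp_hom_def localization_hom_def fwd_class_id2)
    then show ?thesis
      using that \<Phi>.on_unit_simps[of A] \<Psi>.on_unit_simps[of A] by simp
  qed
  then show ?thesis
    using obj arr cell comp by (simp add: eq_hom_def)
qed

lemma factorizations_unique_Loc: "factorizations_unique M Loc (localization_hom M \<W>) B"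
  unfolding factorizations_unique_def
  using eq_hom_on_fwd_class eq_hom_pseudonaturally_equivalent by blast

end

text \<open>The head of the list is traversed first and so stands on the right of the composite. The
  final 1-cell \<open>k\<close> is an argument because the empty list does not determine which
  identity to return. The value of \<open>inv2\<close> is meaningful when \<phi> sends
  \<open>w\<close> to an invertible 2-cell.\<close>

fun eval_steps :: "('p, 'n, 'd) bicat \<Rightarrow> ('c \<Rightarrow> 'd) \<Rightarrow> 'c step list \<Rightarrow> 'n \<Rightarrow> 'd" where
  "eval_steps B \<phi> [] k = id2 B k"
| "eval_steps B \<phi> (Fwd \<alpha> # xs) k = eval_steps B \<phi> xs k \<star>\<^bsub>B\<^esub> \<phi> \<alpha>"
| "eval_steps B \<phi> (Bwd w # xs) k = eval_steps B \<phi> xs k \<star>\<^bsub>B\<^esub> inv2 B (\<phi> w)"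

locale inverting_homomorphism = base_of_enrichment M \<W> + homomorphism M B \<Phi>
  for M :: "('o, 'm, 'c) bicat" (structure) and \<W> and B :: "('p, 'n, 'd) bicat" and \<Phi> +
  assumes inverting: "makes_invertible \<W> B \<Phi>"
begin

lemma invertible2_on_weq [simp]: "w \<in> \<W> \<Longrightarrow> invertible2 B (on_cell \<Phi> w)"
  using inverting by (simp add: makes_invertible_def)

abbreviation eval_zigzag :: "'c step list \<Rightarrow> 'm \<Rightarrow> 'd" where
  "eval_zigzag xs g \<equiv> eval_steps B (on_cell \<Phi>) xs (on_arr \<Phi> g)"

lemma eval_zigzag_simps [simp]:
  assumes "path M \<W> f xs g"
  shows "eval_zigzag xs g \<in> cells B" "dom2 B (eval_zigzag xs g) = on_arr \<Phi> f"
    "cod2 B (eval_zigzag xs g) = on_arr \<Phi> g"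
proof -
  have "eval_zigzag xs g \<in> hom2 B (on_arr \<Phi> f) (on_arr \<Phi> g)"
    using assms
  proof (induction xs arbitrary: f)
    case Nil
    then show ?case by (auto simp: hom2_iff)
  next
    case (Cons x xs)
    then show ?case by (cases x) (fastforce simp: hom2_iff)+
  qed
  then show "eval_zigzag xs g \<in> cells B" "dom2 B (eval_zigzag xs g) = on_arr \<Phi> f"
    "cod2 B (eval_zigzag xs g) = on_arr \<Phi> g"
    by (auto simp: hom2_iff)
qed

lemma eval_zigzag_append:
  "path M \<W> f xs g \<Longrightarrow> path M \<W> g ys h \<Longrightarrow>
    eval_zigzag (xs @ ys) h = eval_zigzag ys h \<star>\<^bsub>B\<^esub> eval_zigzag xs g"
proof (induction xs arbitrary: f)
  case Nil
  then show ?case by auto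
next
  case (Cons x xs)
  show ?case
  proof (cases x)
    case (Fwd \<alpha>)
    then have *: "\<alpha> \<in> cells M" "path M \<W> (cod2 M \<alpha>) xs g" using Cons.prems by auto
    then show ?thesis
      using Fwd Cons.IH[OF *(2) Cons.prems(2)] Cons.prems(2) by simp
  next
    case (Bwd w)
    then have *: "w \<in> \<W>" "path M \<W> (dom2 M w) xs g" using Cons.prems by auto
    then show ?thesis
      using Bwd Cons.IH[OF *(2) Cons.prems(2)] Cons.prems(2) by simp
  qed
qed

lemma eval_zigzag_replace:
  assumes "path M \<W> f xs h" "path M \<W> h us k" "path M \<W> h vs k" "path M \<W> k ys g"
    and "eval_zigzag us k = eval_zigzag vs k"
  shows "eval_zigzag (xs @ us @ ys) g = eval_zigzag (xs @ vs @ ys) g"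
  using assms eval_zigzag_append[of f xs h "us @ ys" g] eval_zigzag_append[of h us k ys g]
    eval_zigzag_append[of f xs h "vs @ ys" g] eval_zigzag_append[of h vs k ys g]
  by (simp add: path_appendI)

text \<open>Replacing a segment inside a context changes nothing when the segment keeps its value.
  For the four generating rules this is preservation of composites and identities by \<Phi>, and the
  two laws of an inverse.\<close>

lemma eval_zigzag_cong:
  assumes "zigzag_eq M \<W> z z'"
  shows "eval_zigzag (fst (snd z)) (snd (snd z)) = eval_zigzag (fst (snd z')) (snd (snd z'))"
  using assms
proof induction
  case (trans z z' z'')
  then show ?case by simp
next
  case (vcomp f xs \<alpha> \<beta> ys g)
  then obtain h k where "path M \<W> f xs h" "path M \<W> h [Fwd \<alpha>, Fwd \<beta>] k" "path M \<W> k ys g"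
    unfolding path_append by blast
  then show ?case
    using eval_zigzag_replace[of f xs h "[Fwd \<alpha>, Fwd \<beta>]" k "[Fwd (\<beta> \<star> \<alpha>)]" ys g] by auto
next
  case (id2 e f xs ys g)
  then obtain h k where "path M \<W> f xs h" "path M \<W> h [Fwd (id2 M e)] k" "path M \<W> k ys g"
    unfolding path_append by blast
  then show ?case
    using eval_zigzag_replace[of f xs h "[Fwd (id2 M e)]" k "[]" ys g] id2.hyps(1) by auto
next
  case (fwd_bwd f xs w ys g)
  then obtain h k where "path M \<W> f xs h" "path M \<W> h [Fwd w, Bwd w] k" "path M \<W> k ys g"
    unfolding path_append by blast
  then show ?case
    using eval_zigzag_replace[of f xs h "[Fwd w, Bwd w]" k "[]" ys g] by auto
next
  case (bwd_fwd f xs w ys g)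
  then obtain h k where "path M \<W> f xs h" "path M \<W> h [Bwd w, Fwd w] k" "path M \<W> k ys g"
    unfolding path_append by blast
  then show ?case
    using eval_zigzag_replace[of f xs h "[Bwd w, Fwd w]" k "[]" ys g] by auto
qed simp_all

text \<open>Evaluation is constant on a class, so its image is a singleton and no representative has
  to be chosen.\<close>

definition extend_cell :: "('m, 'c) zigzag set \<Rightarrow> 'd" where
  "extend_cell X = the_elem ((\<lambda>(f, xs, g). eval_zigzag xs g) ` X)"

lemma extend_cell_zclass:
  assumes "path M \<W> f xs g"
  shows "extend_cell (zclass f xs g) = eval_zigzag xs g"
proof -
  have "(\<lambda>(f, xs, g). eval_zigzag xs g) ` zclass f xs g = {eval_zigzag xs g}" (is "?S = _")
  proof
    show "?S \<subseteq> {eval_zigzag xs g}"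
      using eval_zigzag_cong by (fastforce dest: zclass_member(4) zclass_member(2))
    show "{eval_zigzag xs g} \<subseteq> ?S"
      using zclass_refl[OF assms] by force
  qed
  then show ?thesis by (simp add: extend_cell_def)
qed

lemma extend_cell_simps [simp]:
  assumes "X \<in> cells Loc"
  shows "extend_cell X \<in> cells B" "dom2 B (extend_cell X) = on_arr \<Phi> (dom2 Loc X)"
    "cod2 B (extend_cell X) = on_arr \<Phi> (cod2 Loc X)"
  using assms by (auto simp: cells_Loc extend_cell_zclass)

lemma extend_cell_id2 [simp]: "f \<in> arrs M \<Longrightarrow> extend_cell (id2 Loc f) = id2 B (on_arr \<Phi> f)"
  by (simp add: id2_Loc extend_cell_zclass)

lemma extend_cell_vcomp [simp]:
  "X \<in> cells Loc \<Longrightarrow> Y \<in> cells Loc \<Longrightarrow> dom2 Loc Y = cod2 Loc X \<Longrightarrow>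
    extend_cell (Y \<star>\<^bsub>Loc\<^esub> X) = extend_cell Y \<star>\<^bsub>B\<^esub> extend_cell X"
  by (auto simp: cells_Loc vcomp_zclass extend_cell_zclass path_appendI eval_zigzag_append)

lemma extend_cell_fwd_class [simp]: "\<alpha> \<in> cells M \<Longrightarrow> extend_cell (fwd_class M \<W> \<alpha>) = on_cell \<Phi> \<alpha>"
  by (simp add: fwd_class_eq extend_cell_zclass)

text \<open>Naturality in each argument separately extends from forward classes, where it is
  naturality of the comparison cells of \<Phi> against an identity. The two are combined through the
  factorization of a horizontal composite into whiskerings.\<close>

lemma on_comp_extend_natural:
  assumes X: "X \<in> cells Loc" and Y: "Y \<in> cells Loc" and YX: "src M (dom2 Loc Y) = trg M (dom2 Loc X)"
  shows "on_comp \<Phi> (cod2 Loc Y) (cod2 Loc X) \<star>\<^bsub>B\<^esub> (extend_cell Y \<boxtimes>\<^bsub>B\<^esub> extend_cell X)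
      = extend_cell (Y \<boxtimes>\<^bsub>Loc\<^esub> X) \<star>\<^bsub>B\<^esub> on_comp \<Phi> (dom2 Loc Y) (dom2 Loc X)"
proof -
  let ?f = "dom2 Loc X" and ?f' = "cod2 Loc X" and ?g = "dom2 Loc Y" and ?g' = "cod2 Loc Y"
  have nat_X: "on_comp \<Phi> g ?f' \<star>\<^bsub>B\<^esub> (id2 B (on_arr \<Phi> g) \<boxtimes>\<^bsub>B\<^esub> extend_cell X)
      = extend_cell (id2 Loc g \<boxtimes>\<^bsub>Loc\<^esub> X) \<star>\<^bsub>B\<^esub> on_comp \<Phi> g ?f"
    if "g \<in> arrs M" "src M g = trg M ?f" for g
  proof (rule natural_extend[OF B.vertical_category_axioms, where U="src M ?f" and V="trg M ?f"
      and F\<^sub>0="\<lambda>f. on_arr \<Phi> g \<otimes>\<^bsub>B\<^esub> on_arr \<Phi> f" and G\<^sub>0="\<lambda>f. on_arr \<Phi> (g \<otimes> f)"])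
    fix \<alpha> assume "\<alpha> \<in> cells M" "dom2 M \<alpha> \<in> hom1 M (src M ?f) (trg M ?f)"
    then show "on_comp \<Phi> g (cod2 M \<alpha>) \<star>\<^bsub>B\<^esub> (id2 B (on_arr \<Phi> g) \<boxtimes>\<^bsub>B\<^esub> extend_cell (fwd_class M \<W> \<alpha>))
      = extend_cell (id2 Loc g \<boxtimes>\<^bsub>Loc\<^esub> fwd_class M \<W> \<alpha>) \<star>\<^bsub>B\<^esub> on_comp \<Phi> g (dom2 M \<alpha>)"
      using on_comp_natural'[of \<alpha> "id2 M g"] that by (simp add: hom1_iff fwd_class_whisker)
  qed (use that X in \<open>auto simp: hom_functor_def hom1_iff hom2_iff B.whisker_left_vcomp whisker_left_Loc_vcomp\<close>)
  have nat_Y: "on_comp \<Phi> ?g' f \<star>\<^bsub>B\<^esub> (extend_cell Y \<boxtimes>\<^bsub>B\<^esub> id2 B (on_arr \<Phi> f))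
      = extend_cell (Y \<boxtimes>\<^bsub>Loc\<^esub> id2 Loc f) \<star>\<^bsub>B\<^esub> on_comp \<Phi> ?g f"
    if "f \<in> arrs M" "src M ?g = trg M f" for f
  proof (rule natural_extend[OF B.vertical_category_axioms, where U="src M ?g" and V="trg M ?g"
      and F\<^sub>0="\<lambda>g. on_arr \<Phi> g \<otimes>\<^bsub>B\<^esub> on_arr \<Phi> f" and G\<^sub>0="\<lambda>g. on_arr \<Phi> (g \<otimes> f)"])
    fix \<beta> assume "\<beta> \<in> cells M" "dom2 M \<beta> \<in> hom1 M (src M ?g) (trg M ?g)"
    then show "on_comp \<Phi> (cod2 M \<beta>) f \<star>\<^bsub>B\<^esub> (extend_cell (fwd_class M \<W> \<beta>) \<boxtimes>\<^bsub>B\<^esub> id2 B (on_arr \<Phi> f))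
      = extend_cell (fwd_class M \<W> \<beta> \<boxtimes>\<^bsub>Loc\<^esub> id2 Loc f) \<star>\<^bsub>B\<^esub> on_comp \<Phi> (dom2 M \<beta>) f"
      using on_comp_natural'[of "id2 M f" \<beta>] that by (simp add: hom1_iff fwd_class_whisker)
  qed (use that Y in \<open>auto simp: hom_functor_def hom1_iff hom2_iff B.whisker_right_vcomp whisker_right_Loc_vcomp\<close>)
  note [simp] = X Y YX
  have "on_comp \<Phi> ?g' ?f' \<star>\<^bsub>B\<^esub> (extend_cell Y \<boxtimes>\<^bsub>B\<^esub> extend_cell X)
      = on_comp \<Phi> ?g' ?f' \<star>\<^bsub>B\<^esub> ((id2 B (on_arr \<Phi> ?g') \<boxtimes>\<^bsub>B\<^esub> extend_cell X) \<star>\<^bsub>B\<^esub>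
          (extend_cell Y \<boxtimes>\<^bsub>B\<^esub> id2 B (on_arr \<Phi> ?f)))"
    by (simp add: B.interchange')
  also have "\<dots> = extend_cell (id2 Loc ?g' \<boxtimes>\<^bsub>Loc\<^esub> X) \<star>\<^bsub>B\<^esub> (on_comp \<Phi> ?g' ?f \<star>\<^bsub>B\<^esub>
          (extend_cell Y \<boxtimes>\<^bsub>B\<^esub> id2 B (on_arr \<Phi> ?f)))"
    by (intro B.vcomp_eq_reassoc nat_X) simp_all
  also have "\<dots> = (extend_cell (id2 Loc ?g' \<boxtimes>\<^bsub>Loc\<^esub> X) \<star>\<^bsub>B\<^esub> extend_cell (Y \<boxtimes>\<^bsub>Loc\<^esub> id2 Loc ?f)) \<star>\<^bsub>B\<^esub>
          on_comp \<Phi> ?g ?f"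
    by (simp add: nat_Y)
  also have "extend_cell (id2 Loc ?g' \<boxtimes>\<^bsub>Loc\<^esub> X) \<star>\<^bsub>B\<^esub> extend_cell (Y \<boxtimes>\<^bsub>Loc\<^esub> id2 Loc ?f)
      = extend_cell (Y \<boxtimes>\<^bsub>Loc\<^esub> X)"
    using hcomp_Loc_eq[of X Y] by simp
  finally show ?thesis .
qed

text \<open>Objects and 1-cells of the localization are those of \<open>M\<close>, so every
  component except the one on 2-cells is taken over from \<Phi>; this makes the factorization
  strict.\<close>

definition extension :: "('o, 'm, ('m, 'c) zigzag set, 'p, 'n, 'd) bimorphism" where
  "extension = \<lparr>on_obj = on_obj \<Phi>, on_arr = on_arr \<Phi>, on_cell = extend_cell,
     on_comp = on_comp \<Phi>, on_unit = on_unit \<Phi>\<rparr>"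

text \<open>The coherence laws mention only constraint cells, which are forward classes and evaluate
  to the images under \<Phi> of those of \<open>M\<close>; hence they are the laws of \<Phi>. The
  law with genuinely new content is naturality of the comparison cells.\<close>

lemma homomorphism_extension: "homomorphism Loc B extension"
proof (unfold_locales, goal_cases)
  case (8 X f f' Y g g')
  then show ?case using on_comp_extend_natural[of X Y] by (auto simp: extension_def hom2_iff)
next
  case (11 f U V g W h X)
  then show ?case using on_associator'[of f g h] by (auto simp: extension_def hom1_iff)
next
  case (12 f U V)
  then show ?case using on_lunitor'[of f] by (auto simp: extension_def hom1_iff)
next
  case (13 f U V)
  then show ?case using on_runitor'[of f] by (auto simp: extension_def hom1_iff)
qed (auto simp: extension_def hom1_iff hom2_iff)

lemma eq_hom_extension: "eq_hom M \<Phi> (comp_hom B extension (localization_hom M \<W>))"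
  by (simp add: eq_hom_def comp_hom_def localization_hom_def extension_def)

end

lemma (in base_of_enrichment) factorizations_exist_Loc:
  assumes "bicategory B"
  shows "factorizations_exist M \<W> Loc (localization_hom M \<W>) B"
  unfolding factorizations_exist_def
proof (intro allI impI, elim conjE)
  fix \<Phi> assume "homomorphism M B \<Phi>" "makes_invertible \<W> B \<Phi>"
  then interpret inverting_homomorphism M \<W> B \<Phi>
    by (simp add: inverting_homomorphism_def inverting_homomorphism_axioms_def base_of_enrichment_axioms)
  show "\<exists>\<Phi>'. homomorphism Loc B \<Phi>' \<and> eq_hom M \<Phi> (comp_hom B \<Phi>' (localization_hom M \<W>))"
    using homomorphism_extension eq_hom_extension by blast
qed

section \<open>Uniqueness up to biequivalence\<close>

lemma eq_hom_round_trip: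
  assumes "homomorphism M C L" "homomorphism C D P" "homomorphism D C Q"
    "eq_hom M L' (comp_hom D P L)" "eq_hom M L (comp_hom C Q L')"
  shows "eq_hom M (comp_hom C (comp_hom C Q P) L) (comp_hom C (id_hom C) L)"
proof -
  \<comment> \<open>\<open>Q\<close> after \<open>P\<close> after \<open>L\<close> is
    \<open>Q\<close> after \<open>L'\<close>, which is \<open>L\<close>; rebracketing and inserting
    the identity turn this into two factorizations of \<open>L\<close> through itself.\<close>
  have "eq_hom M (comp_hom C Q (comp_hom D P L)) L"
    using eq_hom_comp_hom[OF assms(4), of C Q] assms(5) eq_hom_sym eq_hom_trans by blast
  then show ?thesis
    using eq_hom_comp_hom_assoc[OF assms(1-3)] eq_hom_comp_hom_id_hom[OF assms(1)] eq_hom_sym eq_hom_trans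
    by blast
qed

text \<open>
  Two universal homomorphisms factor through each other; both round trips are factorizations of a
  universal homomorphism through itself, as is the identity.
\<close>

lemma universal_homomorphisms_biequivalence:
  assumes K: "homomorphism M K L\<^sub>1" "makes_invertible \<W> K L\<^sub>1"
    and N: "homomorphism M N L\<^sub>2" "makes_invertible \<W> N L\<^sub>2"
    and univ_K: "factorizations_exist M \<W> K L\<^sub>1 N" "factorizations_unique M K L\<^sub>1 K"
    and univ_N: "factorizations_exist M \<W> N L\<^sub>2 K" "factorizations_unique M N L\<^sub>2 N"
  shows "\<exists>E. biequivalence K N E \<and> eq_hom M L\<^sub>2 (comp_hom N E L\<^sub>1)"
proof -
  have bicat: "bicategory K" "bicategory N"
    using K(1) N(1) by (auto simp: homomorphism_def)
  obtain E where E: "homomorphism K N E" "eq_hom M L\<^sub>2 (comp_hom N E L\<^sub>1)"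
    using univ_K(1) N unfolding factorizations_exist_def by blast
  obtain G where G: "homomorphism N K G" "eq_hom M L\<^sub>1 (comp_hom K G L\<^sub>2)"
    using univ_N(1) K unfolding factorizations_exist_def by blast
  note round_trip_K = eq_hom_round_trip[OF K(1) E(1) G(1) E(2) G(2)]
    and round_trip_N = eq_hom_round_trip[OF N(1) G(1) E(1) G(2) E(2)]
  have "pseudonaturally_equivalent K K (comp_hom K G E) (id_hom K)"
    using round_trip_K univ_K(2) homomorphism_comp_hom[OF E(1) G(1)] homomorphism_id_hom[OF bicat(1)]
    unfolding factorizations_unique_def by blast
  moreover have "pseudonaturally_equivalent N N (comp_hom N E G) (id_hom N)"
    using round_trip_N univ_N(2) homomorphism_comp_hom[OF G(1) E(1)] homomorphism_id_hom[OF bicat(2)]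
    unfolding factorizations_unique_def by blast
  ultimately show ?thesis
    using E G(1) unfolding biequivalence_def by blast
qed

text \<open>In the uniqueness clause the universal property of \<open>N\<close> is assumed at two
  types, since HOL cannot quantify over types: at that of the localization it provides the
  homomorphism back from \<open>N\<close>, and at that of \<open>N\<close> it compares the round
  trip on \<open>N\<close> with the identity. The resulting biequivalence also carries one universal
  homomorphism to the other.\<close>

theorem proposition30:
  fixes M :: "('o, 'm, 'c) bicat" and \<W> :: "'c set"
  assumes "base_of_enrichment M \<W>"
  shows
    "bicategory (localization M \<W>) \<and>
     homomorphism M (localization M \<W>) (localization_hom M \<W>) \<and>
     makes_invertible \<W> (localization M \<W>) (localization_hom M \<W>) \<and>
     (\<forall>(B :: ('p, 'n, 'd) bicat) \<Phi>.
        bicategory B \<and> homomorphism M B \<Phi> \<and> makes_invertible \<W> B \<Phi> \<longrightarrow>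
        (\<exists>\<Phi>'. homomorphism (localization M \<W>) B \<Phi>' \<and>
              eq_hom M \<Phi> (comp_hom B \<Phi>' (localization_hom M \<W>)))) \<and>
     (\<forall>B :: ('p, 'n, 'd) bicat. bicategory B \<longrightarrow>
        factorizations_unique M (localization M \<W>) (localization_hom M \<W>) B) \<and>
     (\<forall>(N :: ('q, 'l, 'e) bicat) L.
        bicategory N \<and> homomorphism M N L \<and> makes_invertible \<W> N L \<and>
        (\<forall>B :: ('o, 'm, ('m, 'c) zigzag set) bicat. bicategory B \<longrightarrow>
           factorizations_exist M \<W> N L B \<and> factorizations_unique M N L B) \<and>
        (\<forall>B :: ('q, 'l, 'e) bicat. bicategory B \<longrightarrow>
           factorizations_exist M \<W> N L B \<and> factorizations_unique M N L B) \<longrightarrow>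
        (\<exists>E. biequivalence (localization M \<W>) N E \<and>
             eq_hom M L (comp_hom N E (localization_hom M \<W>))))"
proof -
  interpret base_of_enrichment M \<W> by fact
  have "factorizations_exist M \<W> Loc (localization_hom M \<W>) B" if "bicategory B"
    for B :: "('p, 'n, 'd) bicat"
    using factorizations_exist_Loc[OF that] .
  then show ?thesis
    using bicategory_Loc homomorphism_localization_hom makes_invertible_localization_hom
      factorizations_unique_Loc
      universal_homomorphisms_biequivalence[OF homomorphism_localization_hom makes_invertible_localization_hom
        _ _ factorizations_exist_Loc factorizations_unique_Loc]
    unfolding factorizations_exist_def by blast
qed

end
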